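(* Let $m\ge1$ and write $[m]=\{1,\dots,m\}$, $I=[0,1]$. Every continuous linear functional $\chi$ on $D([0,1]^m)$ has a unique representation $$\chi(f)=\sum_{J\subseteq[m]}\chi_J(f)$$ such that for every $J=\{j_1,\dots,j_\ell\}\subseteq[m]$, with $0\le\ell\le m$, writing $J^{c}:=[m]\setminus J=\{j'_1,\dots,j'_{m-\ell}\}$, $$\chi_J(f)=\sum_{t_{j_1},\dots,t_{j_\ell}\in(0,1]}\ \int_{I^{m-\ell}}\Delta_Jf(t_1,\dots,t_m)\,\mathrm d\mu_{J;t_{j_1},\dots,t_{j_\ell}}(t_{j'_1},\dots,t_{j'_{m-\ell}}),$$ where each $\mu_{J;t_{j_1},\dots,t_{j_\ell}}$ is a signed Borel measure on $I^{m-\ell}$ and $$\|\mu_J\|:=\sum_{t_{j_1},\dots,t_{j_\ell}\in(0,1]}\|\mu_{J;t_{j_1},\dots,t_{j_\ell}}\|<\infty .$$ Furthermore, $$2^{-m}\|\chi\|\le\sum_{J\subseteq[m]}\|\mu_J\|\le3^m\|\chi\| .$$ Conversely, every such family of signed Borel measures $\mu_{J;t_{j_1},\dots,t_{j_\ell}}$ satisfying $\|\mu_J\|<\infty$ for every $J\subseteq[m]$ defines a continuous linear functional on $D([0,1]^m)$ by the two displayed formulas for $\chi$ and $\chi_J$.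
   Context: $D([0,1]^m)$ is the set of functions $f:[0,1]^m\to\mathbb R$ such that at every $t=(t_1,\dots,t_m)\in[0,1]^m$ the limit of $f(s)$ exists (as a finite real number) as $s\to t$ within each set $J_1\times\dots\times J_m$, where each $J_i$ is either $[t_i,1]$ or $[0,t_i)$ (the latter only if $t_i>0$). It is a Banach space with the norm $\|f\|=\sup_{t\in[0,1]^m}|f(t)|$. For $i\in[m]$, $\Delta_if(t_1,\dots,t_m):=f(t_1,\dots,t_m)-f(t_1,\dots,t_i-,\dots,t_m)$, where $f(t_1,\dots,t_i-,\dots,t_m):=\lim_{s\nearrow t_i,\,s<t_i}f(t_1,\dots,s,\dots,t_m)$ ($s$ in position $i$) if $t_i>0$, and $\Delta_if(t):=0$ if $t_i=0$. For $J=\{j_1,\dots,j_\ell\}\subseteq[m]$, $\Delta_Jf:=\Delta_{j_1}\cdots\Delta_{j_\ell}f$, a function on $[0,1]^m$ (the operators $\Delta_i$ commute; $\Delta_\emptyset f=f$). All measures are finite. The norm of a signed measure is its total variation. The sum over $t_{j_1},\dots,t_{j_\ell}\in(0,1]$ has only countably many non-zero terms because $\|\mu_J\|<\infty$. For $J=\emptyset$ there is no sum, $\mu_\emptyset$ is a single signed Borel measure on $I^m$ and $\chi_\emptyset(f)=\int_{I^m}f\,\mathrm d\mu_\emptyset$. For $J=[m]$, each $\mu_{[m];t_1,\dots,t_m}$ is a signed measure on the one-point space $I^0$, i.e. a real number, and $\chi_{[m]}(f)=\sum_{t_1,\dots,t_m\in(0,1]}\mu_{[m];t_1,\dots,t_m}\,\Delta_{[m]}f(t_1,\dots,t_m)$.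 Uniqueness means that the measures $\mu_{J;t_{j_1},\dots,t_{j_\ell}}$ are uniquely determined by $\chi$. *)

theory Defs
  imports "HOL-Analysis.Analysis"
begin

text \<open>
  The index set $[m]$ is a nonempty finite linearly ordered type \<^typ>\<open>'m\<close> with $m$ elements
  (every $m \ge 1$ occurs), and points of $[0,1]^m$ are functions \<^typ>\<open>'m \<Rightarrow> real\<close>
  with the product topology.
\<close>

definition unit_cube :: "('m \<Rightarrow> real) set" where
  "unit_cube = Pi UNIV (\<lambda>_. {0..1})"

text \<open>
  The filter \<^term>\<open>inf (nhds t) (principal S)\<close> is used instead of \<^term>\<open>at t within S\<close> because the
  latter removes \<^term>\<open>t\<close>.  The point \<^term>\<open>t\<close> lies in the orthant whose factors are all
  $[t_i,1]$, and there the limit is meant to be $f(t)$ (for $m = 1$: right-continuity).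
\<close>

definition in_D :: "(('m::finite \<Rightarrow> real) \<Rightarrow> real) \<Rightarrow> bool" where
  "in_D f \<longleftrightarrow>
     (\<forall>t\<in>unit_cube. \<forall>J. (\<forall>i. J i = {t i..1} \<or> (0 < t i \<and> J i = {0..<t i})) \<longrightarrow>
        (\<exists>l. (f \<longlongrightarrow> l) (inf (nhds t) (principal (Pi UNIV J)))))"

lemma compact_unit_cube: "compact (unit_cube :: ('m::finite \<Rightarrow> real) set)"
proof -
  have "compactin (product_topology (\<lambda>_. euclideanreal) (UNIV::'m set)) (PiE UNIV (\<lambda>_. {0..1}))"
    by (subst compactin_PiE) auto
  then show ?thesis
    by (simp add: unit_cube_def PiE_UNIV_domain euclidean_product_topology)
qed

lemma in_D_locally_bounded:
  fixes f :: "('m::finite \<Rightarrow> real) \<Rightarrow> real"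
  assumes f: "in_D f" and t: "t \<in> unit_cube"
  shows "\<exists>U B. open U \<and> t \<in> U \<and> (\<forall>s\<in>U \<inter> unit_cube. \<bar>f s\<bar> \<le> B)"
proof -
  define Js where "Js K = (\<lambda>i. if i \<in> K then {0..<t i} else {t i..1})" for K
  define KK where "KK = {K. \<forall>i\<in>K. 0 < t i}"
  have "\<exists>U B. open U \<and> t \<in> U \<and> (\<forall>s\<in>U \<inter> Pi UNIV (Js K). \<bar>f s\<bar> \<le> B)" if K: "K \<in> KK" for K
  proof -
    have "\<forall>i. Js K i = {t i..1} \<or> (0 < t i \<and> Js K i = {0..<t i})"
      using K by (auto simp: Js_def KK_def)
    then obtain l where l: "(f \<longlongrightarrow> l) (inf (nhds t) (principal (Pi UNIV (Js K))))"
      using f t unfolding in_D_def by blast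
    have "eventually (\<lambda>s. dist (f s) l < 1) (inf (nhds t) (principal (Pi UNIV (Js K))))"
      using tendstoD[OF l, of 1] by simp
    then obtain U where "open U" "t \<in> U" "\<forall>s\<in>U. s \<in> Pi UNIV (Js K) \<longrightarrow> dist (f s) l < 1"
      unfolding eventually_inf_principal eventually_nhds by blast
    then show ?thesis
      by (intro exI[of _ U] exI[of _ "\<bar>l\<bar> + 1"]) (force simp: dist_real_def)
  qed
  then obtain U B where UB: "\<And>K. K \<in> KK \<Longrightarrow> open (U K)" "\<And>K. K \<in> KK \<Longrightarrow> t \<in> U K"
    "\<And>K s. K \<in> KK \<Longrightarrow> s \<in> U K \<Longrightarrow> s \<in> Pi UNIV (Js K) \<Longrightarrow> \<bar>f s\<bar> \<le> B K"
    by (metis IntI)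
  have fin: "finite KK" by simp
  show ?thesis
  proof (intro exI conjI ballI)
    show "open (\<Inter>K\<in>KK. U K)" using fin UB(1) by (intro open_INT) auto
    show "t \<in> (\<Inter>K\<in>KK. U K)" using UB(2) by auto
    fix s assume s: "s \<in> (\<Inter>K\<in>KK. U K) \<inter> unit_cube"
    define K where "K = {i. s i < t i}"
    have sc: "0 \<le> s i" "s i \<le> 1" for i
      using s by (auto simp: unit_cube_def)
    have "K \<in> KK" unfolding KK_def K_def using sc by (auto intro: le_less_trans)
    moreover have "s \<in> Pi UNIV (Js K)"
      using sc by (auto simp: Js_def K_def)
    ultimately have "\<bar>f s\<bar> \<le> B K" using UB(3) s by blast
    also have "\<dots> \<le> (\<Sum>K\<in>KK. \<bar>B K\<bar>)"
      using fin \<open>K \<in> KK\<close> by (meson abs_ge_self abs_ge_zero member_le_sum order_trans)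
    finally show "\<bar>f s\<bar> \<le> (\<Sum>K\<in>KK. \<bar>B K\<bar>)" .
  qed
qed

lemma in_D_bounded:
  fixes f :: "('m::finite \<Rightarrow> real) \<Rightarrow> real"
  assumes f: "in_D f"
  shows "\<exists>B. \<forall>t\<in>unit_cube. \<bar>f t\<bar> \<le> B"
proof -
  obtain U B where U: "\<And>t. t \<in> unit_cube \<Longrightarrow> open (U t)" "\<And>t. t \<in> unit_cube \<Longrightarrow> t \<in> U t"
    and B: "\<And>t s. t \<in> unit_cube \<Longrightarrow> s \<in> U t \<inter> unit_cube \<Longrightarrow> \<bar>f s\<bar> \<le> B t"
    using in_D_locally_bounded[OF f] by metis
  obtain C where C: "C \<subseteq> unit_cube" "finite C" "unit_cube \<subseteq> (\<Union>t\<in>C. U t)"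
    by (rule compactE_image[OF compact_unit_cube, of unit_cube U]) (use U in auto)
  have "\<bar>f s\<bar> \<le> (\<Sum>t\<in>C. \<bar>B t\<bar>)" if s: "s \<in> unit_cube" for s
  proof -
    obtain t where t: "t \<in> C" "s \<in> U t" using C s by blast
    then have "\<bar>f s\<bar> \<le> B t" using B C s by blast
    also have "\<dots> \<le> (\<Sum>t\<in>C. \<bar>B t\<bar>)"
      using C(2) t(1) by (meson abs_ge_self abs_ge_zero member_le_sum order_trans)
    finally show ?thesis .
  qed
  then show ?thesis by blast
qed

lemma in_D_compose2:
  assumes "in_D f" "in_D g"
    and h: "\<And>F a b. (f \<longlongrightarrow> a) F \<Longrightarrow> (g \<longlongrightarrow> b) F \<Longrightarrow> ((\<lambda>t. h (f t) (g t)) \<longlongrightarrow> h a b) F"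
  shows "in_D (\<lambda>t. h (f t) (g t))"
  unfolding in_D_def
proof (intro ballI allI impI)
  fix t :: "'a \<Rightarrow> real" and J
  assume "t \<in> unit_cube" and "\<forall>i. J i = {t i..1} \<or> (0 < t i \<and> J i = {0..<t i})"
  then obtain a b where "(f \<longlongrightarrow> a) (inf (nhds t) (principal (Pi UNIV J)))"
    "(g \<longlongrightarrow> b) (inf (nhds t) (principal (Pi UNIV J)))"
    using assms(1,2) unfolding in_D_def by metis
  from h[OF this] show "\<exists>l. ((\<lambda>t. h (f t) (g t)) \<longlongrightarrow> l) (inf (nhds t) (principal (Pi UNIV J)))"
    by (rule exI)
qed

text \<open>
  A function on $[0,1]^m$ is represented by its extension by 0 to all of \<^typ>\<open>'m \<Rightarrow> real\<close>.
\<close>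

typedef (overloaded) ('m::finite) dspace =
  "{f :: ('m \<Rightarrow> real) \<Rightarrow> real. in_D f \<and> (\<forall>t. t \<notin> unit_cube \<longrightarrow> f t = 0)}"
  morphisms dapply Abs_dspace
  by (rule exI[of _ "\<lambda>_. 0"]) (auto simp: in_D_def)

setup_lifting type_definition_dspace

lemma dspace_eqI: "(\<And>t. t \<in> unit_cube \<Longrightarrow> dapply f t = dapply g t) \<Longrightarrow> f = g"
  by transfer (metis ext)

lemma dapply_bounded: "\<exists>B. \<forall>t\<in>unit_cube. \<bar>dapply f t\<bar> \<le> B"
  using in_D_bounded dapply by blast

instantiation dspace :: (finite) real_vector
begin

lift_definition zero_dspace :: "'a dspace" is "\<lambda>_. 0"
  by (auto simp: in_D_def)

lift_definition uminus_dspace :: "'a dspace \<Rightarrow> 'a dspace" is "\<lambda>f t. - f t"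
  using in_D_compose2[of _ _ "\<lambda>a b. - a"] by (auto intro: tendsto_minus)

lift_definition plus_dspace :: "'a dspace \<Rightarrow> 'a dspace \<Rightarrow> 'a dspace" is "\<lambda>f g t. f t + g t"
  using in_D_compose2[of _ _ "\<lambda>a b. a + b"] by (auto intro: tendsto_add)

lift_definition minus_dspace :: "'a dspace \<Rightarrow> 'a dspace \<Rightarrow> 'a dspace" is "\<lambda>f g t. f t - g t"
  using in_D_compose2[of _ _ "\<lambda>a b. a - b"] by (auto intro: tendsto_diff)

lift_definition scaleR_dspace :: "real \<Rightarrow> 'a dspace \<Rightarrow> 'a dspace" is "\<lambda>c f t. c * f t"
  using in_D_compose2[of _ _ "\<lambda>a b. c * a" for c] by (auto intro: tendsto_mult_left)

instance
  by standard (transfer; auto simp: algebra_simps)+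

end

instantiation dspace :: (finite) real_normed_vector
begin

definition norm_dspace :: "'a dspace \<Rightarrow> real" where
  "norm_dspace f = (SUP t\<in>unit_cube. \<bar>dapply f t\<bar>)"

definition dist_dspace :: "'a dspace \<Rightarrow> 'a dspace \<Rightarrow> real" where
  "dist_dspace f g = norm (f - g)"

definition sgn_dspace :: "'a dspace \<Rightarrow> 'a dspace" where
  "sgn_dspace f = f /\<^sub>R norm f"

definition uniformity_dspace :: "('a dspace \<times> 'a dspace) filter" where
  "uniformity_dspace = (INF e\<in>{0<..}. principal {(f, g). dist f g < e})"

definition open_dspace :: "'a dspace set \<Rightarrow> bool" where
  "open_dspace U = (\<forall>f\<in>U. eventually (\<lambda>(f', g). f' = f \<longrightarrow> g \<in> U) uniformity)"

instance
proof
  have ne: "(unit_cube :: ('a \<Rightarrow> real) set) \<noteq> {}"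
    by (auto simp: unit_cube_def intro!: exI[of _ "\<lambda>_. 0"])
  have bdd: "bdd_above ((\<lambda>t. \<bar>dapply f t\<bar>) ` unit_cube)" for f :: "'a dspace"
    using dapply_bounded[of f] unfolding bdd_above_def by auto
  have le_norm: "\<bar>dapply f t\<bar> \<le> norm f" if "t \<in> unit_cube" for f :: "'a dspace" and t
    unfolding norm_dspace_def by (rule cSUP_upper[OF that bdd])
  have norm_le: "norm f \<le> B" if "\<And>t. t \<in> unit_cube \<Longrightarrow> \<bar>dapply f t\<bar> \<le> B" for f :: "'a dspace" and B
    unfolding norm_dspace_def by (rule cSUP_least[OF ne that])
  have norm_ge0: "0 \<le> norm f" for f :: "'a dspace"
    using ne le_norm[of _ f] by (meson abs_ge_zero all_not_in_conv order_trans)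
  fix f g h :: "'a dspace" and a b :: real and U :: "'a dspace set"
  show "dist f g = norm (f - g)" by (fact dist_dspace_def)
  show "sgn f = f /\<^sub>R norm f" by (fact sgn_dspace_def)
  show "(uniformity :: ('a dspace \<times> 'a dspace) filter)
      = (INF e\<in>{0<..}. principal {(f, g). dist f g < e})"
    by (fact uniformity_dspace_def)
  show "open U = (\<forall>f\<in>U. eventually (\<lambda>(f', g). f' = f \<longrightarrow> g \<in> U) uniformity)"
    by (fact open_dspace_def)
  show "norm f = 0 \<longleftrightarrow> f = 0"
  proof
    assume 0: "norm f = 0"
    show "f = 0"
    proof (rule dspace_eqI)
      fix t :: "'a \<Rightarrow> real" assume "t \<in> unit_cube"
      from le_norm[OF this, of f] 0 show "dapply f t = dapply 0 t"
        by (simp add: zero_dspace.rep_eq)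
    qed
  next
    assume "f = 0"
    then have "norm f \<le> 0" by (intro norm_le) (simp add: zero_dspace.rep_eq)
    with norm_ge0[of f] show "norm f = 0" by simp
  qed
  show "norm (f + g) \<le> norm f + norm g"
  proof (rule norm_le)
    fix t :: "'a \<Rightarrow> real" assume t: "t \<in> unit_cube"
    show "\<bar>dapply (f + g) t\<bar> \<le> norm f + norm g"
      using le_norm[OF t, of f] le_norm[OF t, of g] by (simp add: plus_dspace.rep_eq)
  qed
  have scale_le: "norm (c *\<^sub>R k) \<le> \<bar>c\<bar> * norm k" for c :: real and k :: "'a dspace"
    using le_norm[of _ k]
    by (intro norm_le) (simp add: scaleR_dspace.rep_eq abs_mult mult_left_mono)
  show "norm (a *\<^sub>R f) = \<bar>a\<bar> * norm f"
  proof (cases "a = 0")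
    case True
    then show ?thesis using scale_le[of a f] norm_ge0[of "a *\<^sub>R f"] by simp
  next
    case False
    have inv: "inverse a *\<^sub>R a *\<^sub>R f = f"
      using False by transfer (auto simp: field_simps)
    have "\<bar>a\<bar> * norm f \<le> \<bar>a\<bar> * (\<bar>inverse a\<bar> * norm (a *\<^sub>R f))"
      using scale_le[of "inverse a" "a *\<^sub>R f"] unfolding inv by (rule mult_left_mono) simp
    also have "\<dots> = norm (a *\<^sub>R f)" using False by (simp add: abs_mult[symmetric] mult.assoc[symmetric])
    finally show ?thesis using scale_le[of a f] by simp
  qed
qed

end

definition delta :: "'m \<Rightarrow> (('m \<Rightarrow> real) \<Rightarrow> real) \<Rightarrow> ('m \<Rightarrow> real) \<Rightarrow> real" where
  "delta i f t = (if 0 < t i then f t - Lim (at_left (t i)) (\<lambda>s. f (t(i := s))) else 0)"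

text \<open>
  On $D([0,1]^m)$ the operators $\Delta_i$ commute; the order of \<^typ>\<open>'m\<close> only fixes one of the
  equivalent orders of composition $\Delta_{j_1} \cdots \Delta_{j_\ell}$.
\<close>

definition Delta ::
  "'m::{finite,linorder} set \<Rightarrow> (('m \<Rightarrow> real) \<Rightarrow> real) \<Rightarrow> ('m \<Rightarrow> real) \<Rightarrow> real" where
  "Delta J f = foldr delta (sorted_list_of_set J) f"

text \<open>
  A (finite) signed measure on a measurable space \<^term>\<open>M\<close> is a countably additive real set
  function on \<^term>\<open>sets M\<close>; its values on other sets are irrelevant.
  Only the \<open>\<sigma>\<close>-algebra of \<^term>\<open>M\<close> is used, not the measure \<^term>\<open>emeasure M\<close>.
\<close>

definition signed_measure :: "'a measure \<Rightarrow> ('a set \<Rightarrow> real) \<Rightarrow> bool" where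
  "signed_measure M \<mu> \<longleftrightarrow>
     \<mu> {} = 0 \<and>
     (\<forall>A :: nat \<Rightarrow> 'a set. range A \<subseteq> sets M \<longrightarrow> disjoint_family A \<longrightarrow>
        (\<lambda>n. \<mu> (A n)) sums \<mu> (\<Union>n. A n))"

definition total_variation :: "'a measure \<Rightarrow> ('a set \<Rightarrow> real) \<Rightarrow> ennreal" where
  "total_variation M \<mu> =
     (SUP P\<in>{P. finite P \<and> P \<subseteq> sets M \<and> partition_on (space M) P}. \<Sum>A\<in>P. ennreal \<bar>\<mu> A\<bar>)"

text \<open>
  The positive part $\mu^+(A) = \sup \{\mu(B) : B \subseteq A\}$ of the Jordan decomposition; the
  negative part is the positive part of $-\mu$.  As $\mu(\emptyset) = 0$, truncation of negative
  values by \<^const>\<open>ennreal\<close> does not affect the supremum.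
\<close>

definition positive_part :: "'a measure \<Rightarrow> ('a set \<Rightarrow> real) \<Rightarrow> 'a measure" where
  "positive_part M \<mu> =
     measure_of (space M) (sets M) (\<lambda>A. SUP B\<in>{B \<in> sets M. B \<subseteq> A}. ennreal (\<mu> B))"

definition negative_part :: "'a measure \<Rightarrow> ('a set \<Rightarrow> real) \<Rightarrow> 'a measure" where
  "negative_part M \<mu> = positive_part M (\<lambda>A. - \<mu> A)"

definition signed_integrable :: "'a measure \<Rightarrow> ('a set \<Rightarrow> real) \<Rightarrow> ('a \<Rightarrow> real) \<Rightarrow> bool" where
  "signed_integrable M \<mu> f \<longleftrightarrow>
     integrable (positive_part M \<mu>) f \<and> integrable (negative_part M \<mu>) f"

definition signed_integral :: "'a measure \<Rightarrow> ('a set \<Rightarrow> real) \<Rightarrow> ('a \<Rightarrow> real) \<Rightarrow> real" where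
  "signed_integral M \<mu> f =
     (\<integral>x. f x \<partial>positive_part M \<mu>) - (\<integral>x. f x \<partial>negative_part M \<mu>)"

text \<open>
  $I^{K}$ for $K \subseteq [m]$, as extensional functions on \<^term>\<open>K\<close>.  As \<^term>\<open>K\<close> is finite and
  $[0,1]$ is second countable, the product \<open>\<sigma>\<close>-algebra is the Borel \<open>\<sigma>\<close>-algebra of $I^K$.
  For $K = \emptyset$ this is the one-point space.
\<close>

definition cube_space :: "'m set \<Rightarrow> ('m \<Rightarrow> real) measure" where
  "cube_space K = (\<Pi>\<^sub>M i\<in>K. restrict_space borel {0..1})"

text \<open>
  In a family \<open>\<mu>\<close>, the set function \<open>\<mu> J s\<close> stands for $\mu_{J;t_{j_1},\dots,t_{j_\ell}}$, where
  \<open>s \<in> J \<rightarrow>\<^sub>E {0<..1}\<close> is the tuple $(t_j)_{j \in J} \in (0,1]^J$; it lives on $I^{J^c}$.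
\<close>

type_synonym 'm measure_family = "'m set \<Rightarrow> ('m \<Rightarrow> real) \<Rightarrow> ('m \<Rightarrow> real) set \<Rightarrow> real"

definition family_norm :: "'m measure_family \<Rightarrow> 'm set \<Rightarrow> ennreal" where
  "family_norm \<mu> J = (\<Sum>\<^sub>\<infinity>s\<in>J \<rightarrow>\<^sub>E {0<..1}. total_variation (cube_space (- J)) (\<mu> J s))"

definition admissible :: "'m measure_family \<Rightarrow> bool" where
  "admissible \<mu> \<longleftrightarrow>
     (\<forall>J. (\<forall>s\<in>J \<rightarrow>\<^sub>E {0<..1}. signed_measure (cube_space (- J)) (\<mu> J s)) \<and>
          family_norm \<mu> J < \<infinity>)"

definition slice ::
  "'m::{finite,linorder} set \<Rightarrow> 'm dspace \<Rightarrow> ('m \<Rightarrow> real) \<Rightarrow> ('m \<Rightarrow> real) \<Rightarrow> real" where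
  "slice J f s x = Delta J (dapply f) (merge J (- J) (s, x))"

definition chi_part ::
  "'m::{finite,linorder} measure_family \<Rightarrow> 'm set \<Rightarrow> 'm dspace \<Rightarrow> real" where
  "chi_part \<mu> J f =
     (\<Sum>\<^sub>\<infinity>s\<in>J \<rightarrow>\<^sub>E {0<..1}. signed_integral (cube_space (- J)) (\<mu> J s) (slice J f s))"

definition chi_part_converges ::
  "'m::{finite,linorder} measure_family \<Rightarrow> 'm set \<Rightarrow> 'm dspace \<Rightarrow> bool" where
  "chi_part_converges \<mu> J f \<longleftrightarrow>
     (\<forall>s\<in>J \<rightarrow>\<^sub>E {0<..1}. signed_integrable (cube_space (- J)) (\<mu> J s) (slice J f s)) \<and>
     (\<lambda>s. signed_integral (cube_space (- J)) (\<mu> J s) (slice J f s)) summable_on (J \<rightarrow>\<^sub>E {0<..1})"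

definition represents ::
  "'m::{finite,linorder} measure_family \<Rightarrow> ('m dspace \<Rightarrow>\<^sub>L real) \<Rightarrow> bool" where
  "represents \<mu> \<phi> \<longleftrightarrow>
     admissible \<mu> \<and> (\<forall>f. blinfun_apply \<phi> f = (\<Sum>J\<in>UNIV. chi_part \<mu> J f))"

definition same_family :: "'m measure_family \<Rightarrow> 'm measure_family \<Rightarrow> bool" where
  "same_family \<mu> \<nu> \<longleftrightarrow>
     (\<forall>J. \<forall>s\<in>J \<rightarrow>\<^sub>E {0<..1}. \<forall>A\<in>sets (cube_space (- J)). \<mu> J s A = \<nu> J s A)"

end

theory Submission
  imports Defs
begin

text \<open>
  Splitting every \<open>t > 0\<close> in $[0,1]$ into the two points \<open>t-\<close> and \<open>t\<close> turns
  $D([0,1]^m)$ into the continuous functions on a compact space $X$, whose points are pairs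
  \<open>(t, L)\<close> of a point of the cube and the set \<open>L\<close> of coordinates approached from the left.
  The Riesz theorem on $X$ is replaced by an elementary argument: $X$ has a base of clopen sets, the
  functional gives a bounded finitely additive set function on the clopen algebra, its positive and
  negative variations are countably additive there by compactness, and Caratheodory's theorem
  extends them to measures $\nu^\pm$.  The measure $\mu_{J;s}$ is $(-1)^{|J|}$ times the image of
  $\nu^+ - \nu^-$ restricted to $J \subseteq L$, $t_J = s$.  Everything in sight is continuous in $f$ and
  the indicators of the boxes $\prod_i [a_i, 1]$ span a dense subspace, so the representation need
  only be checked on them, where it is the expansion of
  $\prod_i (1[t_i \ge a_i] - 1[t_i = a_i, i \in L])$.  Evaluating on the same boxes, with
  coordinates avoiding the countably many atoms, also gives uniqueness.
\<close>

subsection \<open>Jordan decomposition of bounded charges\<close>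

text \<open>Taking the left limit in coordinate i is the operator 1 - \<Delta>_i, so the value of f
  at (t, L) is the sum over J \<subseteq> L of (-1)^|J| \<Delta>_J f(t). Integrating this expansion
  over X is what produces the sign (-1)^|J| and the condition J \<subseteq> L. The obstacle is that
  the set J \<subseteq> L alone need not lie in the \<sigma>-algebra generated by the clopen sets:
  for m = 1 every set of that \<sigma>-algebra separates t from t- for only countably many t. It
  becomes measurable once t_J is fixed to a tuple s, which explains the sum over s; this loses
  nothing, because \<Delta>_J of a step function vanishes for all but finitely many t_J and step
  functions are dense. For fixed J the cells of different s are disjoint, so each norm of \<mu>_J is
  at most the norm of \<chi>, and the 2^m index sets together give at most 2^m \<le> 3^m times that
  norm. In the other direction \<Delta>_J enlarges the sup norm by a factor of at most
  2^|J|.\<close>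

definition upper_variation :: "'a set set \<Rightarrow> ('a set \<Rightarrow> real) \<Rightarrow> 'a set \<Rightarrow> real" where
  "upper_variation M l A = (SUP B\<in>{B \<in> M. B \<subseteq> A}. l B)"

text \<open>\<open>M\<close> is only an algebra because the locale has two kinds of instances: the
  clopen algebra of the split cube, where \<open>l\<close> comes from a functional, and the
  \<sigma>-algebra of a signed measure.\<close>

locale charge = algebra \<Omega> M for \<Omega> :: "'a set" and M +
  fixes l :: "'a set \<Rightarrow> real"
  assumes charge_empty: "l {} = 0"
    and charge_Un: "\<And>A B. A \<in> M \<Longrightarrow> B \<in> M \<Longrightarrow> A \<inter> B = {} \<Longrightarrow> l (A \<union> B) = l A + l B"
    and charge_bounded: "\<exists>c. \<forall>A\<in>M. \<bar>l A\<bar> \<le> c"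
begin

lemma charge_uminus: "charge \<Omega> M (\<lambda>A. - l A)"
  using charge_empty charge_Un charge_bounded by unfold_locales auto

lemma bdd: "bdd_above (l ` {B \<in> M. B \<subseteq> A})"
proof -
  obtain c where "\<And>A. A \<in> M \<Longrightarrow> \<bar>l A\<bar> \<le> c" using charge_bounded by auto
  then have "\<And>A. A \<in> M \<Longrightarrow> l A \<le> c" by (meson abs_le_D1)
  then show ?thesis unfolding bdd_above_def by blast
qed

lemma upper_variation_upper: "B \<in> M \<Longrightarrow> B \<subseteq> A \<Longrightarrow> l B \<le> upper_variation M l A"
  unfolding upper_variation_def by (rule cSUP_upper[OF _ bdd]) auto

lemma upper_variation_least:
  assumes "\<And>B. B \<in> M \<Longrightarrow> B \<subseteq> A \<Longrightarrow> l B \<le> c"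
  shows "upper_variation M l A \<le> c"
  unfolding upper_variation_def by (rule cSUP_least) (use assms in auto)

lemma upper_variation_nonneg: "0 \<le> upper_variation M l A"
  using upper_variation_upper[of "{}" A] charge_empty by auto

lemma upper_variation_mono: "A \<subseteq> B \<Longrightarrow> upper_variation M l A \<le> upper_variation M l B"
  by (rule upper_variation_least) (auto intro: upper_variation_upper)

lemma upper_variation_empty [simp]: "upper_variation M l {} = 0"
  by (intro antisym upper_variation_least upper_variation_nonneg) (use charge_empty in auto)

text \<open>A subset of \<open>A \<union> B\<close> is cut along \<open>A\<close> and
  \<open>B\<close>; conversely nearly optimal subsets of \<open>A\<close> and \<open>B\<close> are
  disjoint and can be joined.\<close>

lemma upper_variation_Un:
  assumes A: "A \<in> M" and B: "B \<in> M" and d: "A \<inter> B = {}"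
  shows "upper_variation M l (A \<union> B) = upper_variation M l A + upper_variation M l B"
proof (rule antisym)
  show "upper_variation M l (A \<union> B) \<le> upper_variation M l A + upper_variation M l B"
  proof (rule upper_variation_least)
    fix C assume C: "C \<in> M" "C \<subseteq> A \<union> B"
    have "l C = l (C \<inter> A) + l (C \<inter> B)"
      using charge_Un[of "C \<inter> A" "C \<inter> B"] A B C d
      by (metis Int Int_Un_distrib inf.absorb_iff1 inf_assoc inf_bot_right inf_left_commute)
    also have "\<dots> \<le> upper_variation M l A + upper_variation M l B"
      using A B C by (intro add_mono upper_variation_upper) auto
    finally show "l C \<le> upper_variation M l A + upper_variation M l B" .
  qed
  have "l C + l D \<le> upper_variation M l (A \<union> B)" if "C \<in> M" "C \<subseteq> A" "D \<in> M" "D \<subseteq> B" for C D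
  proof -
    have "l C + l D = l (C \<union> D)" using charge_Un[of C D] that d by force
    also have "\<dots> \<le> upper_variation M l (A \<union> B)" using that by (intro upper_variation_upper) auto
    finally show ?thesis .
  qed
  \<comment> \<open>The two suprema are taken one at a time: over \<open>C\<close> with
    \<open>D\<close> fixed, then over \<open>D\<close>.\<close>
  then have "upper_variation M l A \<le> upper_variation M l (A \<union> B) - l D" if "D \<in> M" "D \<subseteq> B" for D
    using that by (intro upper_variation_least) (auto simp: algebra_simps)
  then have "upper_variation M l B \<le> upper_variation M l (A \<union> B) - upper_variation M l A"
    by (intro upper_variation_least) (auto simp: algebra_simps)
  then show "upper_variation M l A + upper_variation M l B \<le> upper_variation M l (A \<union> B)" by simp
qed

lemma charge_Diff: "A \<in> M \<Longrightarrow> B \<in> M \<Longrightarrow> B \<subseteq> A \<Longrightarrow> l (A - B) = l A - l B"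
  using charge_Un[of "A - B" B] Diff[of A B] by (simp add: Un_absorb2 Int_commute[of _ B])

text \<open>Complementation \<open>B \<mapsto> A - B\<close> exchanges the two suprema, since
  \<open>l (A - B) = l A - l B\<close>.\<close>

lemma upper_variation_jordan:
  assumes A: "A \<in> M"
  shows "upper_variation M l A = l A + upper_variation M (\<lambda>A. - l A) A"
proof (rule antisym)
  interpret neg: charge \<Omega> M "\<lambda>A. - l A" by (rule charge_uminus)
  show "upper_variation M l A \<le> l A + upper_variation M (\<lambda>A. - l A) A"
  proof (rule upper_variation_least)
    fix B assume B: "B \<in> M" "B \<subseteq> A"
    show "l B \<le> l A + upper_variation M (\<lambda>A. - l A) A"
      using neg.upper_variation_upper[of "A - B" A] charge_Diff[OF A B] Diff[OF A B(1)] by auto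
  qed
  have "upper_variation M (\<lambda>A. - l A) A \<le> upper_variation M l A - l A"
  proof (rule neg.upper_variation_least)
    fix B assume B: "B \<in> M" "B \<subseteq> A"
    show "- l B \<le> upper_variation M l A - l A"
      using upper_variation_upper[of "A - B" A] charge_Diff[OF A B] Diff[OF A B(1)] by auto
  qed
  then show "l A + upper_variation M (\<lambda>A. - l A) A \<le> upper_variation M l A" by simp
qed

text \<open>Write p and n for the two variations of \<Omega>. As n = p - l(\<Omega>), the sum is 2p
  - l(\<Omega>), and the hypothesis says 2 l(B) \<le> c + l(\<Omega>), which bounds p. For a
  functional, the hypothesis is its value on the function that is 1 on B and -1 off B.\<close>

lemma upper_variation_sum_le:
  assumes "\<And>B. B \<in> M \<Longrightarrow> l B - l (\<Omega> - B) \<le> c"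
  shows "upper_variation M l \<Omega> + upper_variation M (\<lambda>A. - l A) \<Omega> \<le> c"
proof -
  have "upper_variation M l \<Omega> \<le> (c + l \<Omega>) / 2"
  proof (rule upper_variation_least)
    fix B assume B: "B \<in> M" "B \<subseteq> \<Omega>"
    show "l B \<le> (c + l \<Omega>) / 2" using assms[OF B(1)] charge_Diff[OF top B] by simp
  qed
  then show ?thesis using upper_variation_jordan[OF top] by simp
qed

end

subsection \<open>Signed measures\<close>

lemma total_variation_upper:
  assumes "signed_measure M \<mu>" "B \<in> sets M"
  shows "ennreal (\<bar>\<mu> B\<bar> + \<bar>\<mu> (space M - B)\<bar>) \<le> total_variation M \<mu>"
proof -
  \<comment> \<open>\<open>partition_on\<close> forbids empty blocks; dropping \<open>{}\<close>
    does not change the sum because \<open>\<mu> {} = 0\<close>.\<close>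
  define P where "P = {B, space M - B} - {{}}"
  have *: "finite P \<and> P \<subseteq> sets M \<and> partition_on (space M) P"
    using assms sets.sets_into_space[OF assms(2)] 
    by (auto simp: P_def partition_on_def disjoint_def)
  have "(\<Sum>A\<in>P. ennreal \<bar>\<mu> A\<bar>) = (\<Sum>A\<in>{B, space M - B}. ennreal \<bar>\<mu> A\<bar>)"
    unfolding P_def using assms(1) by (intro sum.mono_neutral_left) (auto simp: signed_measure_def)
  also have "\<dots> = ennreal (\<bar>\<mu> B\<bar> + \<bar>\<mu> (space M - B)\<bar>)"
  proof (cases "B = space M - B")
    case True
    then have "B = {}" using sets.sets_into_space[OF assms(2)] by auto
    then show ?thesis using True assms(1) by (simp add: signed_measure_def)
  qed (simp add: ennreal_plus)
  finally show ?thesis unfolding total_variation_def using * by (metis (mono_tags, lifting) SUP_upper mem_Collect_eq)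
qed

locale finite_signed_measure =
  fixes M :: "'a measure" and \<mu> :: "'a set \<Rightarrow> real"
  assumes signed: "signed_measure M \<mu>" and finite_variation: "total_variation M \<mu> < \<infinity>"
begin

lemma abs_le_variation:
  "B \<in> sets M \<Longrightarrow> \<bar>\<mu> B\<bar> + \<bar>\<mu> (space M - B)\<bar> \<le> enn2real (total_variation M \<mu>)"
  using total_variation_upper[OF signed, of B] finite_variation
  by (cases "total_variation M \<mu>") (auto simp del: ennreal_plus)

lemma sums: "range A \<subseteq> sets M \<Longrightarrow> disjoint_family A \<Longrightarrow> (\<lambda>n. \<mu> (A n)) sums \<mu> (\<Union>n. A n)"
  using signed by (auto simp: signed_measure_def)

sublocale charge "space M" "sets M" \<mu>
proof
  show "\<mu> {} = 0" using signed by (simp add: signed_measure_def)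
  show "\<exists>c. \<forall>A\<in>sets M. \<bar>\<mu> A\<bar> \<le> c"
    using abs_le_variation by (meson abs_ge_zero add_increasing2 le_add_same_cancel1 order_trans)
  fix A B assume AB: "A \<in> sets M" "B \<in> sets M" "A \<inter> B = {}"
  have "(\<lambda>n. \<mu> (binaryset A B n)) sums \<mu> (\<Union>n. binaryset A B n)"
    using AB by (intro sums) (auto simp: range_binaryset_eq disjoint_family_on_def binaryset_def)
  moreover have "(\<lambda>n. \<mu> (binaryset A B n)) sums (\<mu> A + \<mu> B)"
    by (rule binaryset_sums) fact
  ultimately show "\<mu> (A \<union> B) = \<mu> A + \<mu> B"
    by (simp add: UN_binaryset_eq sums_unique2)
qed

lemma finite_signed_measure_uminus: "finite_signed_measure M (\<lambda>A. - \<mu> A)"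
proof
  show "signed_measure M (\<lambda>A. - \<mu> A)"
    using charge_empty sums unfolding signed_measure_def by (auto intro: sums_minus)
  show "total_variation M (\<lambda>A. - \<mu> A) < \<infinity>"
    using finite_variation by (simp add: total_variation_def)
qed

text \<open>Finite additivity bounds the partial sums by the variation of the union. For the other
  inequality a competitor \<open>B\<close> is cut into the pieces \<open>B \<inter> A n\<close>, and
  countable additivity of \<open>\<mu>\<close> itself is applied to them.\<close>

lemma upper_variation_sums:
  assumes A: "range A \<subseteq> sets M" "disjoint_family A"
  shows "(\<lambda>n. upper_variation (sets M) \<mu> (A n)) sums upper_variation (sets M) \<mu> (\<Union>n. A n)"
proof -
  let ?p = "upper_variation (sets M) \<mu>"
  have part: "(\<Sum>k<n. ?p (A k)) = ?p (\<Union>k<n. A k)" for n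
  proof (induction n)
    case (Suc n)
    have "?p ((\<Union>k<n. A k) \<union> A n) = ?p (\<Union>k<n. A k) + ?p (A n)"
      using A by (intro upper_variation_Un) (auto simp: disjoint_family_on_def, metis Int_iff empty_iff nat_neq_iff)
    then show ?case using Suc by (simp add: lessThan_Suc Un_commute add.commute)
  qed simp
  have le: "(\<Sum>k<n. ?p (A k)) \<le> ?p (\<Union>n. A n)" for n
    unfolding part by (intro upper_variation_mono) auto
  have summ: "summable (\<lambda>n. ?p (A n))"
    by (rule bounded_imp_summable[of _ "?p (\<Union>n. A n)"])
      (use le[of "Suc _"] upper_variation_nonneg in \<open>auto simp: lessThan_Suc_atMost\<close>)
  moreover have "suminf (\<lambda>n. ?p (A n)) = ?p (\<Union>n. A n)"
  proof (rule antisym)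
    show "suminf (\<lambda>n. ?p (A n)) \<le> ?p (\<Union>n. A n)"
      by (rule suminf_le_const[OF summ le])
    show "?p (\<Union>n. A n) \<le> suminf (\<lambda>n. ?p (A n))"
    proof (rule upper_variation_least)
      fix B assume B: "B \<in> sets M" "B \<subseteq> (\<Union>n. A n)"
      have "(\<lambda>n. \<mu> (B \<inter> A n)) sums \<mu> (\<Union>n. B \<inter> A n)"
        using A B by (intro sums) (auto simp: disjoint_family_on_def)
      moreover have "(\<Union>n. B \<inter> A n) = B" using B by auto
      moreover have "B \<inter> A n \<in> sets M" for n using A B by auto
      ultimately show "\<mu> B \<le> suminf (\<lambda>n. ?p (A n))"
        using sums_le[OF upper_variation_upper _ summable_sums[OF summ], of "\<lambda>n. B \<inter> A n" "\<mu> B"] by simp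
    qed
  qed
  ultimately show ?thesis by (simp add: sums_iff)
qed

section \<open>The positive and negative parts as finite measures\<close>

lemma sets_positive_part [simp, measurable_cong]: "sets (positive_part M \<mu>) = sets M"
  and space_positive_part [simp]: "space (positive_part M \<mu>) = space M"
  by (simp_all add: positive_part_def)

text \<open>The defining supremum of \<open>positive_part\<close> is taken in
  \<open>ennreal\<close>, the variation in the reals; they agree because the charge is bounded. Once
  this is known, \<open>upper_variation_sums\<close> supplies the countable additivity that
  \<open>measure_of\<close> asks for.\<close>

lemma emeasure_positive_part:
  assumes A: "A \<in> sets M"
  shows "emeasure (positive_part M \<mu>) A = ennreal (upper_variation (sets M) \<mu> A)"
proof -
  have eq: "(SUP B\<in>{B \<in> sets M. B \<subseteq> A}. ennreal (\<mu> B)) = ennreal (upper_variation (sets M) \<mu> A)"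
    (is "?S A = _") for A
  proof (rule antisym)
    show le: "?S A \<le> ennreal (upper_variation (sets M) \<mu> A)"
      by (intro SUP_least ennreal_leI upper_variation_upper) auto
    have "?S A < top"
      by (rule le_less_trans[OF le]) simp
    then have S: "?S A = ennreal (enn2real (?S A))"
      by (simp add: less_top)
    have "\<mu> B \<le> enn2real (?S A)" if "B \<in> sets M" "B \<subseteq> A" for B
    proof -
      have "ennreal (\<mu> B) \<le> ?S A" using that by (intro SUP_upper) auto
      then have "ennreal (\<mu> B) \<le> ennreal (enn2real (?S A))" by (subst (asm) S)
      then show ?thesis by (subst (asm) ennreal_le_iff) simp_all
    qed
    then have "ennreal (upper_variation (sets M) \<mu> A) \<le> ennreal (enn2real (?S A))"
      by (intro ennreal_leI upper_variation_least)
    also note S[symmetric]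
    finally show "ennreal (upper_variation (sets M) \<mu> A) \<le> ?S A" .
  qed
  show ?thesis
    unfolding positive_part_def eq
  proof (subst emeasure_measure_of_sigma)
    show "sigma_algebra (space M) (sets M)" by (rule sets.sigma_algebra_axioms)
    show "positive (sets M) (\<lambda>A. ennreal (upper_variation (sets M) \<mu> A))"
      by (simp add: positive_def)
    show "countably_additive (sets M) (\<lambda>A. ennreal (upper_variation (sets M) \<mu> A))"
      unfolding countably_additive_def
      by (intro allI impI suminf_ennreal_eq upper_variation_sums upper_variation_nonneg)
  qed (use A in auto)
qed

lemma finite_positive_part: "finite_measure (positive_part M \<mu>)"
  by (rule finite_measureI) (simp add: emeasure_positive_part)

lemma measure_positive_part:
  "A \<in> sets M \<Longrightarrow> measure (positive_part M \<mu>) A = upper_variation (sets M) \<mu> A"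
  by (simp add: measure_def emeasure_positive_part upper_variation_nonneg)

interpretation neg: finite_signed_measure M "\<lambda>A. - \<mu> A"
  by (rule finite_signed_measure_uminus)

lemma sets_negative_part [simp, measurable_cong]: "sets (negative_part M \<mu>) = sets M"
  and space_negative_part [simp]: "space (negative_part M \<mu>) = space M"
  by (simp_all add: negative_part_def)

lemma finite_negative_part: "finite_measure (negative_part M \<mu>)"
  unfolding negative_part_def by (rule neg.finite_positive_part)

lemma measure_jordan:
  "A \<in> sets M \<Longrightarrow> \<mu> A = measure (positive_part M \<mu>) A - measure (negative_part M \<mu>) A"
  using upper_variation_jordan[of A]
  by (simp add: measure_positive_part negative_part_def neg.measure_positive_part)

lemma measure_parts_le:
  "measure (positive_part M \<mu>) (space M) + measure (negative_part M \<mu>) (space M)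
     \<le> enn2real (total_variation M \<mu>)"
  unfolding measure_positive_part[OF sets.top] negative_part_def neg.measure_positive_part[OF sets.top]
proof (rule upper_variation_sum_le)
  fix B assume "B \<in> sets M"
  from abs_le_variation[OF this] show "\<mu> B - \<mu> (space M - B) \<le> enn2real (total_variation M \<mu>)"
    by linarith
qed

section \<open>Integrals of bounded functions against a signed measure\<close>

lemma signed_integrableI:
  assumes [measurable]: "f \<in> borel_measurable M" and bd: "\<And>x. x \<in> space M \<Longrightarrow> \<bar>f x\<bar> \<le> c"
  shows "signed_integrable M \<mu> f"
proof -
  interpret p: finite_measure "positive_part M \<mu>" by (rule finite_positive_part)
  interpret n: finite_measure "negative_part M \<mu>" by (rule finite_negative_part)
  show ?thesis unfolding signed_integrable_def
    by (intro conjI p.integrable_const_bound[of _ c] n.integrable_const_bound[of _ c])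
      (auto intro!: AE_I2 simp: bd)
qed

lemma signed_integral_bound:
  assumes f: "f \<in> borel_measurable M" and bd: "\<And>x. x \<in> space M \<Longrightarrow> \<bar>f x\<bar> \<le> c" and c: "0 \<le> c"
  shows "\<bar>signed_integral M \<mu> f\<bar> \<le> c * enn2real (total_variation M \<mu>)"
proof -
  interpret p: finite_measure "positive_part M \<mu>" by (rule finite_positive_part)
  interpret n: finite_measure "negative_part M \<mu>" by (rule finite_negative_part)
  have int: "integrable (positive_part M \<mu>) f" "integrable (negative_part M \<mu>) f"
    using signed_integrableI[OF f bd] by (auto simp: signed_integrable_def)
  have *: "\<bar>\<integral>x. f x \<partial>N\<bar> \<le> c * measure N (space M)"
    if N: "finite_measure N" "integrable N f" "space N = space M" for N
  proof -
    interpret finite_measure N by fact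
    have "\<bar>\<integral>x. f x \<partial>N\<bar> \<le> (\<integral>x. \<bar>f x\<bar> \<partial>N)" by (rule integral_abs_bound)
    also have "\<dots> \<le> (\<integral>x. c \<partial>N)"
      using N bd by (intro integral_mono) auto
    finally show ?thesis by (simp add: N(3) mult.commute)
  qed
  have "\<bar>\<integral>x. f x \<partial>positive_part M \<mu>\<bar> \<le> c * measure (positive_part M \<mu>) (space M)"
    "\<bar>\<integral>x. f x \<partial>negative_part M \<mu>\<bar> \<le> c * measure (negative_part M \<mu>) (space M)"
    using int by (intro *; simp add: finite_positive_part finite_negative_part)+
  then have "\<bar>signed_integral M \<mu> f\<bar>
      \<le> c * (measure (positive_part M \<mu>) (space M) + measure (negative_part M \<mu>) (space M))"
    unfolding signed_integral_def distrib_left by linarith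
  also have "\<dots> \<le> c * enn2real (total_variation M \<mu>)"
    by (intro mult_left_mono measure_parts_le c)
  finally show ?thesis .
qed

lemma signed_integral_cong:
  "(\<And>x. x \<in> space M \<Longrightarrow> f x = g x) \<Longrightarrow> signed_integral M \<mu> f = signed_integral M \<mu> g"
  unfolding signed_integral_def
  by (intro arg_cong2[where f = minus] Bochner_Integration.integral_cong) auto

lemma signed_integral_indicator:
  assumes "A \<in> sets M"
  shows "signed_integral M \<mu> (indicator A) = \<mu> A"
  using assms sets.sets_into_space[OF assms]
  by (simp add: signed_integral_def measure_jordan Int_absorb2 Int_absorb1)

end

lemma signed_integral_add:
  "signed_integrable M \<mu> f \<Longrightarrow> signed_integrable M \<mu> g \<Longrightarrow>
    signed_integral M \<mu> (\<lambda>x. f x + g x) = signed_integral M \<mu> f + signed_integral M \<mu> g"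
  by (simp add: signed_integral_def signed_integrable_def)

lemma signed_integral_cmult:
  "signed_integral M \<mu> (\<lambda>x. c * f x) = c * signed_integral M \<mu> f"
  by (simp add: signed_integral_def algebra_simps)

text \<open>\<open>S\<close> abstracts the preimage under a map that is defined on a part of the
  space only. In the application it is \<open>split_cell J s\<close>, so a measure is restricted to
  a cell and pushed forward in one move.\<close>

lemma signed_measure_diff_measure:
  fixes M :: "'a measure"
  assumes "finite_measure N1" "finite_measure N2" "sets N1 = sets N2"
    and S: "\<And>A. A \<in> sets M \<Longrightarrow> S A \<in> sets N2" "S {} = {}"
      "\<And>A. S (\<Union>n::nat. A n) = (\<Union>n. S (A n))" "\<And>A B. A \<inter> B = {} \<Longrightarrow> S A \<inter> S B = {}"
  shows "signed_measure M (\<lambda>A. c * (measure N1 (S A) - measure N2 (S A)))"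
  unfolding signed_measure_def
proof (intro conjI allI impI)
  show "c * (measure N1 (S {}) - measure N2 (S {})) = 0" by (simp add: S)
  interpret n1: finite_measure N1 by fact
  interpret n2: finite_measure N2 by fact
  fix A :: "nat \<Rightarrow> 'a set" assume A: "range A \<subseteq> sets M" "disjoint_family A"
  have "range (\<lambda>n. S (A n)) \<subseteq> sets N2" "disjoint_family (\<lambda>n. S (A n))"
    using A S(1,4) by (auto simp: disjoint_family_on_def)
  then show "(\<lambda>n. c * (measure N1 (S (A n)) - measure N2 (S (A n)))) sums
      (c * (measure N1 (S (\<Union>n. A n)) - measure N2 (S (\<Union>n. A n))))"
    unfolding S(3)
    by (intro sums_mult sums_diff n1.finite_measure_UNION n2.finite_measure_UNION) (simp_all add: assms(3))
qed

subsection \<open>One-sided limits in orthants\<close>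

lemma unit_cube_iff: "t \<in> unit_cube \<longleftrightarrow> (\<forall>i. 0 \<le> t i \<and> t i \<le> 1)"
  by (auto simp: unit_cube_def Pi_iff)

lemma abs_dapply_le_norm: "\<bar>dapply f t\<bar> \<le> norm f"
proof (cases "t \<in> unit_cube")
  case True
  then show ?thesis
    unfolding norm_dspace_def using dapply_bounded[of f]
    by (intro cSUP_upper) (auto simp: bdd_above_def)
next
  case False
  then show ?thesis using dapply[of f] by simp
qed

lemma norm_dspace_leI:
  assumes "\<And>t. t \<in> unit_cube \<Longrightarrow> \<bar>dapply f t\<bar> \<le> B"
  shows "norm f \<le> B"
  unfolding norm_dspace_def
proof (rule cSUP_least[OF _ assms])
  have "(\<lambda>_. 0) \<in> unit_cube" by (simp add: unit_cube_iff)
  then show "unit_cube \<noteq> {}" by blast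
qed

definition orthant :: "('m \<Rightarrow> real) \<Rightarrow> 'm set \<Rightarrow> ('m \<Rightarrow> real) set" where
  "orthant t L = Pi UNIV (\<lambda>i. if i \<in> L then {0..<t i} else {t i..1})"

definition orthant_filter :: "('m \<Rightarrow> real) \<Rightarrow> 'm set \<Rightarrow> ('m \<Rightarrow> real) filter" where
  "orthant_filter t L = inf (nhds t) (principal (orthant t L))"

text \<open>
  The compactification of $[0,1]^m$ in which every coordinate \<open>t > 0\<close> is split into two points
  \<open>t\<close> and \<open>t-\<close>; the set \<open>L\<close> in \<open>(t, L)\<close> consists of the coordinates which are left limits.
\<close>

definition split_cube :: "(('m \<Rightarrow> real) \<times> 'm set) set" where
  "split_cube = {(t, L). t \<in> unit_cube \<and> (\<forall>i\<in>L. 0 < t i)}"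

text \<open>The value at \<open>(t, L)\<close> of the continuous extension of \<open>f\<close> to
  the split cube. \<open>Lim\<close> says something only where the limit exists and the filter is
  proper, hence the recurring hypothesis \<open>(t, L) \<in> split_cube\<close>.\<close>

definition orthant_lim :: "'m::finite dspace \<Rightarrow> ('m \<Rightarrow> real) \<Rightarrow> 'm set \<Rightarrow> real" where
  "orthant_lim f t L = Lim (orthant_filter t L) (dapply f)"

lemma orthant_iff: "y \<in> orthant t L \<longleftrightarrow>
    (\<forall>i. if i \<in> L then 0 \<le> y i \<and> y i < t i else t i \<le> y i \<and> y i \<le> 1)"
  by (auto simp: orthant_def Pi_iff split: if_splits)

lemma orthant_subset_unit_cube: "t \<in> unit_cube \<Longrightarrow> orthant t L \<subseteq> unit_cube"
  unfolding unit_cube_iff subset_iff orthant_iff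
  by (smt (verit, del_insts))

lemma in_orthantI: "y \<in> unit_cube \<Longrightarrow> y \<in> orthant t {i. y i < t i}"
  by (auto simp: orthant_iff unit_cube_iff not_less)

lemma split_cubeI_less: "y \<in> unit_cube \<Longrightarrow> t \<in> unit_cube \<Longrightarrow> (t, {i. y i < t i}) \<in> split_cube"
  by (auto simp: split_cube_def unit_cube_iff intro: le_less_trans)

lemma open_box: "open {y :: 'm::finite \<Rightarrow> real. \<forall>i. \<bar>y i - t i\<bar> < e}"
proof -
  have "{y. \<forall>i. \<bar>y i - t i\<bar> < e} = Pi\<^sub>E UNIV (\<lambda>i. {x. \<bar>x - t i\<bar> < e})"
    by auto
  moreover have "open {x. \<bar>x - t i\<bar> < e}" for i
    by (intro open_Collect_less continuous_intros)
  ultimately show ?thesis by (simp add: open_PiE)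
qed

lemma eventually_orthant_filter:
  fixes t :: "'m::finite \<Rightarrow> real"
  shows "eventually P (orthant_filter t L) \<longleftrightarrow>
    (\<exists>e>0. \<forall>y\<in>orthant t L. (\<forall>i. \<bar>y i - t i\<bar> < e) \<longrightarrow> P y)"
proof
  assume "eventually P (orthant_filter t L)"
  then obtain U where U: "open U" "t \<in> U" "\<And>y. y \<in> U \<Longrightarrow> y \<in> orthant t L \<Longrightarrow> P y"
    unfolding orthant_filter_def eventually_inf_principal eventually_nhds by blast
  then obtain X where X: "\<And>i. open (X i)" "t \<in> Pi\<^sub>E UNIV X" "Pi\<^sub>E UNIV X \<subseteq> U"
    unfolding open_fun_def openin_product_topology_alt open_openin[symmetric]
    by (metis (no_types, lifting) UNIV_I)
  have "\<exists>e>0. \<forall>x. \<bar>x - t i\<bar> < e \<longrightarrow> x \<in> X i" for i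
    using X(1)[of i] X(2) unfolding open_dist dist_real_def by auto
  then obtain e where e: "\<And>i. 0 < e i" "\<And>i x. \<bar>x - t i\<bar> < e i \<Longrightarrow> x \<in> X i" by metis
  show "\<exists>e>0. \<forall>y\<in>orthant t L. (\<forall>i. \<bar>y i - t i\<bar> < e) \<longrightarrow> P y"
  proof (intro exI conjI ballI impI)
    \<comment> \<open>A basic open set of the product restricts each coordinate separately;
      finiteness of the index type makes the smallest radius positive.\<close>
    show "0 < Min (range e)" using e(1) by simp
    fix y assume y: "y \<in> orthant t L" "\<forall>i. \<bar>y i - t i\<bar> < Min (range e)"
    then have "y \<in> Pi\<^sub>E UNIV X" using e(2) by auto
    then show "P y" using X(3) U(3) y(1) by blast
  qed
next
  assume "\<exists>e>0. \<forall>y\<in>orthant t L. (\<forall>i. \<bar>y i - t i\<bar> < e) \<longrightarrow> P y"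
  then obtain e where "0 < e" "\<forall>y\<in>orthant t L. (\<forall>i. \<bar>y i - t i\<bar> < e) \<longrightarrow> P y" by blast
  then show "eventually P (orthant_filter t L)"
    unfolding orthant_filter_def eventually_inf_principal eventually_nhds
    by (intro exI[of _ "{y. \<forall>i. \<bar>y i - t i\<bar> < e}"]) (auto simp: open_box)
qed

lemma orthant_filter_neq_bot:
  fixes t :: "'m::finite \<Rightarrow> real"
  assumes "(t, L) \<in> split_cube"
  shows "orthant_filter t L \<noteq> bot"
proof
  assume "orthant_filter t L = bot"
  then obtain e where e: "0 < e" "\<And>y. y \<in> orthant t L \<Longrightarrow> \<not> (\<forall>i. \<bar>y i - t i\<bar> < e)"
    using eventually_orthant_filter[of "\<lambda>_. False" t L] by auto
  \<comment> \<open>\<open>max 0\<close> keeps the witness in the cube, and it stays strictly below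
    \<open>t i\<close> because \<open>0 < t i\<close> for \<open>i \<in> L\<close>.\<close>
  define y where "y i = (if i \<in> L then max 0 (t i - e / 2) else t i)" for i
  have "y \<in> orthant t L" "\<forall>i. \<bar>y i - t i\<bar> < e"
    using assms e(1) by (auto simp: orthant_iff y_def split_cube_def unit_cube_iff)
  then show False using e(2) by blast
qed

lemma in_D_iff_split_cube:
  "in_D f \<longleftrightarrow> (\<forall>(t, L)\<in>split_cube. \<exists>l. (f \<longlongrightarrow> l) (orthant_filter t L))"
proof safe
  fix t :: "'a \<Rightarrow> real" and L assume f: "in_D f" and "(t, L) \<in> split_cube"
  then show "\<exists>l. (f \<longlongrightarrow> l) (orthant_filter t L)"
    unfolding orthant_filter_def orthant_def
    by (intro f[unfolded in_D_def, rule_format]) (auto simp: split_cube_def)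
next
  assume *: "\<forall>(t, L)\<in>split_cube. \<exists>l. (f \<longlongrightarrow> l) (orthant_filter t L)"
  show "in_D f"
    unfolding in_D_def
  proof (intro ballI allI impI)
    fix t :: "'a \<Rightarrow> real" and J
    assume t: "t \<in> unit_cube" and J: "\<forall>i. J i = {t i..1} \<or> (0 < t i \<and> J i = {0..<t i})"
    define L where "L = {i. 0 < t i \<and> J i = {0..<t i}}"
    have "J = (\<lambda>i. if i \<in> L then {0..<t i} else {t i..1})"
      using J by (auto simp: L_def fun_eq_iff)
    then have "Pi UNIV J = orthant t L" by (simp add: orthant_def)
    moreover have "(t, L) \<in> split_cube" using t by (auto simp: split_cube_def L_def)
    ultimately show "\<exists>l. (f \<longlongrightarrow> l) (inf (nhds t) (principal (Pi UNIV J)))"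
      using * by (auto simp: orthant_filter_def)
  qed
qed

lemma orthant_lim_tendsto:
  assumes "(t, L) \<in> split_cube"
  shows "(dapply f \<longlongrightarrow> orthant_lim f t L) (orthant_filter t L)"
proof -
  obtain l where "(dapply f \<longlongrightarrow> l) (orthant_filter t L)"
    using assms dapply[of f] in_D_iff_split_cube[of "dapply f"] by auto
  then show ?thesis
    unfolding orthant_lim_def using orthant_filter_neq_bot[OF assms] tendsto_Lim by fast
qed

lemma orthant_lim_eqI:
  "(t, L) \<in> split_cube \<Longrightarrow> (dapply f \<longlongrightarrow> l) (orthant_filter t L) \<Longrightarrow> orthant_lim f t L = l"
  using orthant_lim_tendsto orthant_filter_neq_bot tendsto_unique by blast

lemma orthant_lim_add:
  "(t, L) \<in> split_cube \<Longrightarrow> orthant_lim (f + g) t L = orthant_lim f t L + orthant_lim g t L"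
  by (rule orthant_lim_eqI) (auto simp: plus_dspace.rep_eq intro!: tendsto_add orthant_lim_tendsto)

lemma orthant_lim_scaleR:
  "(t, L) \<in> split_cube \<Longrightarrow> orthant_lim (c *\<^sub>R f) t L = c * orthant_lim f t L"
  by (rule orthant_lim_eqI) (auto simp: scaleR_dspace.rep_eq intro!: tendsto_mult_left orthant_lim_tendsto)

lemma orthant_lim_bound: "(t, L) \<in> split_cube \<Longrightarrow> \<bar>orthant_lim f t L\<bar> \<le> norm f"
  by (rule tendsto_upperbound[OF tendsto_rabs[OF orthant_lim_tendsto]])
    (auto simp: abs_dapply_le_norm orthant_filter_neq_bot)

text \<open>With no coordinate on the left, the orthant contains \<open>t\<close> itself and the
  filter is not punctured at \<open>t\<close>, so the limit is forced to be the value.\<close>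

lemma orthant_lim_empty:
  assumes t: "t \<in> unit_cube"
  shows "orthant_lim f t {} = dapply f t"
proof -
  have *: "(t, {}) \<in> split_cube" using t by (simp add: split_cube_def)
  have "\<bar>dapply f t - orthant_lim f t {}\<bar> < e" if e: "0 < e" for e
  proof -
    have "eventually (\<lambda>y. \<bar>dapply f y - orthant_lim f t {}\<bar> < e) (orthant_filter t {})"
      using tendstoD[OF orthant_lim_tendsto[OF *] e] by (simp add: dist_real_def)
    moreover have "t \<in> orthant t {}" using t by (auto simp: orthant_iff unit_cube_iff)
    ultimately show ?thesis unfolding eventually_orthant_filter by fastforce
  qed
  then have "\<bar>dapply f t - orthant_lim f t {}\<bar> \<le> 0" by (meson less_irrefl not_less)
  then show ?thesis by simp
qed

text \<open>
  For \<open>u < t i\<close> close to \<open>t i\<close>, the orthant of \<open>t(i := u)\<close> is near \<open>t(i := u)\<close> contained in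
  the orthant of \<open>t\<close> with coordinate \<open>i\<close> moved to the left.
\<close>

lemma orthant_lim_at_left:
  assumes t: "(t, insert i L) \<in> split_cube" and i: "i \<notin> L"
  shows "((\<lambda>u. orthant_lim f (t(i := u)) L) \<longlongrightarrow> orthant_lim f t (insert i L)) (at_left (t i))"
proof (rule tendstoI)
  fix e :: real assume e: "0 < e"
  let ?l = "orthant_lim f t (insert i L)"
  have "eventually (\<lambda>y. dist (dapply f y) ?l < e / 2) (orthant_filter t (insert i L))"
    using tendstoD[OF orthant_lim_tendsto[OF t], of "e / 2"] e by simp
  then obtain d where d: "0 < d" and fd: "\<And>y. y \<in> orthant t (insert i L) \<Longrightarrow>
      (\<And>j. \<bar>y j - t j\<bar> < d) \<Longrightarrow> \<bar>dapply f y - ?l\<bar> < e / 2"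
    unfolding eventually_orthant_filter dist_real_def by blast
  have ti: "0 < t i" using t by (simp add: split_cube_def)
  have "dist (orthant_lim f (t(i := u)) L) ?l < e" if u: "max 0 (t i - d) < u" "u < t i" for u
  proof -
    have s: "(t(i := u), L) \<in> split_cube"
      using t u i by (auto simp: split_cube_def unit_cube_iff) (meson less_le_trans less_imp_le)
    have "eventually (\<lambda>y. \<bar>dapply f y - ?l\<bar> \<le> e / 2) (orthant_filter (t(i := u)) L)"
      unfolding eventually_orthant_filter
    proof (intro exI conjI ballI impI)
      \<comment> \<open>The bound \<open>d\<close> keeps the remaining coordinates near
        \<open>t\<close>, the bound \<open>t i - u\<close> prevents \<open>y i\<close> from reaching
        \<open>t i\<close>.\<close>
      show "0 < min d (t i - u)" using d u by simp
      fix y assume y: "y \<in> orthant (t(i := u)) L"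
        "\<forall>j. \<bar>y j - (t(i := u)) j\<bar> < min d (t i - u)"
      have yi: "u \<le> y i" "y i < t i"
        using y i by (auto simp: orthant_iff dest!: spec[of _ i])
      have "y \<in> orthant t (insert i L)"
        unfolding orthant_iff
      proof
        fix j show "if j \<in> insert i L then 0 \<le> y j \<and> y j < t j else t j \<le> y j \<and> y j \<le> 1"
          using y(1) yi u unfolding orthant_iff by (cases "j = i") (auto dest!: spec[of _ j])
      qed
      moreover have "\<bar>y j - t j\<bar> < d" for j
        using y(2)[rule_format, of j] yi u by (cases "j = i") auto
      ultimately show "\<bar>dapply f y - ?l\<bar> \<le> e / 2" using fd less_imp_le by blast
    qed
    then have "\<bar>orthant_lim f (t(i := u)) L - ?l\<bar> \<le> e / 2"
      by (intro tendsto_upperbound[OF tendsto_rabs[OF tendsto_diff[OF orthant_lim_tendsto[OF s] tendsto_const]]]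
          orthant_filter_neq_bot[OF s])
    then show ?thesis using e by (simp add: dist_real_def)
  qed
  then show "eventually (\<lambda>u. dist (orthant_lim f (t(i := u)) L) ?l < e) (at_left (t i))"
    using ti d by (intro eventually_at_leftI[of "max 0 (t i - d)"]) auto
qed

section \<open>Expansion of iterated differences into one-sided limits\<close>

lemma sum_Pow_insert_alternating:
  fixes g :: "'a set \<Rightarrow> real"
  assumes "finite S" "i \<notin> S"
  shows "(\<Sum>L\<in>Pow (insert i S). (-1) ^ card L * g L) =
    (\<Sum>L\<in>Pow S. (-1) ^ card L * g L) - (\<Sum>L\<in>Pow S. (-1) ^ card L * g (insert i L))"
proof -
  have "inj_on (insert i) (Pow S)" using assms(2) by (auto simp: inj_on_def)
  then have "(\<Sum>L\<in>insert i ` Pow S. (-1) ^ card L * g L) = (\<Sum>L\<in>Pow S. (-1) ^ card (insert i L) * g (insert i L))"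
    by (simp add: sum.reindex)
  also have "\<dots> = - (\<Sum>L\<in>Pow S. (-1) ^ card L * g (insert i L))"
    unfolding sum_negf[symmetric]
  proof (rule sum.cong[OF refl])
    fix L assume "L \<in> Pow S"
    then have "card (insert i L) = Suc (card L)"
      using assms finite_subset by (intro card_insert_disjoint) auto
    then show "(-1) ^ card (insert i L) * g (insert i L) = - ((-1) ^ card L * g (insert i L))" by simp
  qed
  finally show ?thesis
    unfolding Pow_insert using assms
    by (subst sum.union_disjoint) auto
qed

text \<open>Each difference operator is the identity minus a left limit, and the product is
  expanded. The head of the list is the outermost operator; its left limit is carried through the
  expansion of the tail by \<open>orthant_lim_at_left\<close>. As the right-hand side depends on
  \<open>set js\<close> only, the order of composition is irrelevant at these points.\<close>

lemma foldr_delta_eq: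
  fixes f :: "'m::finite dspace"
  assumes "distinct js" "t \<in> unit_cube" "\<And>j. j \<in> set js \<Longrightarrow> 0 < t j"
  shows "foldr delta js (dapply f) t = (\<Sum>L\<in>Pow (set js). (-1) ^ card L * orthant_lim f t L)"
  using assms
proof (induction js arbitrary: t)
  case Nil
  then show ?case by (simp add: orthant_lim_empty)
next
  case (Cons i js)
  let ?g = "foldr delta js (dapply f)" and ?S = "\<lambda>t. \<Sum>L\<in>Pow (set js). (-1) ^ card L * orthant_lim f t L"
  have ti: "0 < t i" and i: "i \<notin> set js" using Cons.prems by auto
  have "((\<lambda>u. ?S (t(i := u))) \<longlongrightarrow> (\<Sum>L\<in>Pow (set js). (-1) ^ card L * orthant_lim f t (insert i L))) (at_left (t i))"
    using Cons.prems i
    by (intro tendsto_sum tendsto_mult_left orthant_lim_at_left) (auto simp: split_cube_def)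
  moreover have "eventually (\<lambda>u. ?S (t(i := u)) = ?g (t(i := u))) (at_left (t i))"
  proof (rule eventually_at_leftI[OF _ ti])
    fix u assume u: "u \<in> {0<..<t i}"
    then have "u \<le> 1" using Cons.prems(2) by (auto simp: unit_cube_iff dest!: spec[of _ i])
    then show "?S (t(i := u)) = ?g (t(i := u))"
      using Cons.prems u by (intro Cons.IH[symmetric]) (auto simp: unit_cube_iff)
  qed
  ultimately have "((\<lambda>u. ?g (t(i := u))) \<longlongrightarrow> (\<Sum>L\<in>Pow (set js). (-1) ^ card L * orthant_lim f t (insert i L))) (at_left (t i))"
    by (rule Lim_transform_eventually)
  then have "Lim (at_left (t i)) (\<lambda>u. ?g (t(i := u))) = (\<Sum>L\<in>Pow (set js). (-1) ^ card L * orthant_lim f t (insert i L))"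
    by (intro tendsto_Lim) simp_all
  moreover have "?g t = ?S t" using Cons.prems by (intro Cons.IH) auto
  ultimately show ?case
    using ti sum_Pow_insert_alternating[OF _ i, of "\<lambda>L. orthant_lim f t L"] by (simp add: delta_def[of i])
qed

lemma space_cube_space: "space (cube_space K) = K \<rightarrow>\<^sub>E {0..1}"
  by (simp add: cube_space_def space_PiM)

lemma merge_in_unit_cube:
  "s \<in> J \<rightarrow>\<^sub>E {0<..1} \<Longrightarrow> x \<in> space (cube_space (- J)) \<Longrightarrow> merge J (- J) (s, x) \<in> unit_cube"
  by (auto simp: unit_cube_iff merge_def space_cube_space PiE_iff less_imp_le)

lemma merge_in_split_cube:
  "s \<in> J \<rightarrow>\<^sub>E {0<..1} \<Longrightarrow> x \<in> space (cube_space (- J)) \<Longrightarrow> L \<subseteq> J \<Longrightarrow>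
    (merge J (- J) (s, x), L) \<in> split_cube"
  using merge_in_unit_cube[of s J x] by (auto simp: split_cube_def merge_def PiE_iff)

lemma slice_eq:
  assumes s: "s \<in> J \<rightarrow>\<^sub>E {0<..1}" and x: "x \<in> space (cube_space (- J))"
  shows "slice J f s x = (\<Sum>L\<in>Pow J. (-1) ^ card L * orthant_lim f (merge J (- J) (s, x)) L)"
  unfolding slice_def Delta_def
  using foldr_delta_eq[of "sorted_list_of_set J" "merge J (- J) (s, x)" f] merge_in_unit_cube[OF s x] s
  by (auto simp: merge_def PiE_iff)

lemma slice_add:
  "s \<in> J \<rightarrow>\<^sub>E {0<..1} \<Longrightarrow> x \<in> space (cube_space (- J)) \<Longrightarrow>
    slice J (f + g) s x = slice J f s x + slice J g s x"
  by (simp add: slice_eq orthant_lim_add merge_in_split_cube distrib_left sum.distrib)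

lemma slice_scaleR:
  "s \<in> J \<rightarrow>\<^sub>E {0<..1} \<Longrightarrow> x \<in> space (cube_space (- J)) \<Longrightarrow>
    slice J (c *\<^sub>R f) s x = c * slice J f s x"
  by (simp add: slice_eq orthant_lim_scaleR merge_in_split_cube sum_distrib_left mult.left_commute)

text \<open>The expansion has 2^|J| terms, one per subset of \<open>J\<close>, each of size at most
  \<open>norm f\<close>. This is the origin of the factor 2^(-m) in the lower estimate.\<close>

lemma slice_bound:
  assumes "s \<in> J \<rightarrow>\<^sub>E {0<..1}" "x \<in> space (cube_space (- J))"
  shows "\<bar>slice J f s x\<bar> \<le> 2 ^ card J * norm f"
proof -
  have "\<bar>slice J f s x\<bar> \<le> (\<Sum>L\<in>Pow J. \<bar>(-1) ^ card L * orthant_lim f (merge J (- J) (s, x)) L\<bar>)"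
    unfolding slice_eq[OF assms] by (rule sum_abs)
  also have "\<dots> \<le> (\<Sum>L\<in>Pow J. norm f)"
    using merge_in_split_cube[OF assms] by (intro sum_mono) (auto simp: abs_mult orthant_lim_bound)
  finally show ?thesis by (simp add: card_Pow)
qed

subsection \<open>Step functions are dense\<close>

text \<open>The traces on the cube of the clopen subsets of the split cube: exactly the sets whose
  indicator function belongs to $D$.\<close>

definition regular_sets :: "('m::finite \<Rightarrow> real) set set" where
  "regular_sets = {E. E \<subseteq> unit_cube \<and> (\<forall>t L. (t, L) \<in> split_cube \<longrightarrow>
     eventually (\<lambda>y. y \<in> E) (orthant_filter t L) \<or> eventually (\<lambda>y. y \<notin> E) (orthant_filter t L))}"

definition dindicator :: "('m::finite \<Rightarrow> real) set \<Rightarrow> 'm dspace" where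
  "dindicator E = Abs_dspace (indicator E)"

definition upper_box :: "('m \<Rightarrow> real) \<Rightarrow> ('m \<Rightarrow> real) set" where
  "upper_box a = {y \<in> unit_cube. \<forall>i. a i \<le> y i}"

lift_definition dmult :: "'m::finite dspace \<Rightarrow> 'm dspace \<Rightarrow> 'm dspace" is "\<lambda>f g t. f t * g t"
  using in_D_compose2[of _ _ "(*)"] by (auto intro: tendsto_mult)

lemma eventually_in_unit_cube:
  "(t, L) \<in> split_cube \<Longrightarrow> eventually (\<lambda>y. y \<in> unit_cube) (orthant_filter t L)"
  using orthant_subset_unit_cube[of t L]
  by (auto simp: split_cube_def orthant_filter_def eventually_inf_principal intro!: always_eventually)

lemma regular_setsI:
  assumes "E \<subseteq> unit_cube"
    and "\<And>t L. (t, L) \<in> split_cube \<Longrightarrow>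
      eventually (\<lambda>y. y \<in> E) (orthant_filter t L) \<or> eventually (\<lambda>y. y \<notin> E) (orthant_filter t L)"
  shows "E \<in> regular_sets"
  using assms by (simp add: regular_sets_def)

lemma regular_sets_cases:
  assumes "E \<in> regular_sets" "(t, L) \<in> split_cube"
  obtains "eventually (\<lambda>y. y \<in> E) (orthant_filter t L)"
    | "eventually (\<lambda>y. y \<notin> E) (orthant_filter t L)"
  using assms by (auto simp: regular_sets_def)

lemma regular_sets_subset: "E \<in> regular_sets \<Longrightarrow> E \<subseteq> unit_cube"
  by (simp add: regular_sets_def)

lemma dapply_dindicator:
  assumes "E \<in> regular_sets"
  shows "dapply (dindicator E) = indicator E"
  unfolding dindicator_def
proof (rule Abs_dspace_inverse, intro CollectI conjI)
  have "\<exists>l. (indicator E \<longlongrightarrow> (l :: real)) (orthant_filter t L)" if "(t, L) \<in> split_cube" for t L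
  proof -
    from assms that show ?thesis
    proof (cases rule: regular_sets_cases)
      case 1
      then have "eventually (\<lambda>y. indicator E y = (1 :: real)) (orthant_filter t L)"
        by (rule eventually_mono) simp
      then show ?thesis using tendsto_eventually by blast
    next
      case 2
      then have "eventually (\<lambda>y. indicator E y = (0 :: real)) (orthant_filter t L)"
        by (rule eventually_mono) simp
      then show ?thesis using tendsto_eventually by blast
    qed
  qed
  then show "in_D (indicator E)" unfolding in_D_iff_split_cube by blast
  show "\<forall>t. t \<notin> unit_cube \<longrightarrow> indicator E t = (0 :: real)"
    using assms by (auto simp: regular_sets_def indicator_def)
qed

lemma orthant_lim_dindicator:
  assumes "E \<in> regular_sets" "(t, L) \<in> split_cube"
  shows "orthant_lim (dindicator E) t L = of_bool (eventually (\<lambda>y. y \<in> E) (orthant_filter t L))"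
proof (rule orthant_lim_eqI[OF assms(2)], rule tendsto_eventually)
  show "eventually (\<lambda>y. dapply (dindicator E) y
      = of_bool (eventually (\<lambda>y. y \<in> E) (orthant_filter t L))) (orthant_filter t L)"
  proof (cases "eventually (\<lambda>y. y \<in> E) (orthant_filter t L)")
    case True
    then show ?thesis
      by (rule eventually_mono) (simp add: True dapply_dindicator[OF assms(1)])
  next
    case False
    then have "eventually (\<lambda>y. y \<notin> E) (orthant_filter t L)"
      using regular_sets_cases[OF assms] by blast
    then show ?thesis
      by (rule eventually_mono) (simp add: False dapply_dindicator[OF assms(1)])
  qed
qed

section \<open>Boolean operations on regular sets\<close>

lemma regular_sets_empty [simp]: "{} \<in> regular_sets"
  by (auto simp: regular_sets_def)

lemma regular_sets_Int:
  assumes E: "E \<in> regular_sets" and F: "F \<in> regular_sets"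
  shows "E \<inter> F \<in> regular_sets"
proof (rule regular_setsI)
  show "E \<inter> F \<subseteq> unit_cube" using regular_sets_subset[OF E] by blast
  fix t :: "'a \<Rightarrow> real" and L assume tL: "(t, L) \<in> split_cube"
  show "eventually (\<lambda>y. y \<in> E \<inter> F) (orthant_filter t L) \<or>
      eventually (\<lambda>y. y \<notin> E \<inter> F) (orthant_filter t L)"
    using E tL
  proof (cases rule: regular_sets_cases)
    case 1
    note E = this
    show ?thesis using F tL
    proof (cases rule: regular_sets_cases)
      case 1
      with E show ?thesis by (simp add: eventually_conj)
    next
      case 2
      then have "eventually (\<lambda>y. y \<notin> E \<inter> F) (orthant_filter t L)" by (rule eventually_mono) simp
      then show ?thesis ..
    qed
  next
    case 2
    then have "eventually (\<lambda>y. y \<notin> E \<inter> F) (orthant_filter t L)" by (rule eventually_mono) simp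
    then show ?thesis ..
  qed
qed

lemma regular_sets_Compl:
  assumes "E \<in> regular_sets"
  shows "unit_cube - E \<in> regular_sets"
proof -
  have "eventually (\<lambda>y. y \<in> unit_cube - E) (orthant_filter t L)
      \<or> eventually (\<lambda>y. y \<notin> unit_cube - E) (orthant_filter t L)" if tL: "(t, L) \<in> split_cube" for t L
  proof -
    from assms tL show ?thesis
    proof (cases rule: regular_sets_cases)
      case 1
      then have "eventually (\<lambda>y. y \<notin> unit_cube - E) (orthant_filter t L)"
        by (rule eventually_mono) simp
      then show ?thesis ..
    next
      case 2
      from eventually_conj[OF 2 eventually_in_unit_cube[OF tL]]
      have "eventually (\<lambda>y. y \<in> unit_cube - E) (orthant_filter t L)"
        by (rule eventually_mono) simp
      then show ?thesis ..
    qed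
  qed
  then show ?thesis by (intro regular_setsI) auto
qed

lemma regular_sets_Un:
  assumes "E \<in> regular_sets" "F \<in> regular_sets"
  shows "E \<union> F \<in> regular_sets"
proof -
  have "E \<union> F = unit_cube - (unit_cube - E) \<inter> (unit_cube - F)"
    using assms by (auto simp: regular_sets_def)
  then show ?thesis using assms by (simp add: regular_sets_Int regular_sets_Compl)
qed

text \<open>In a coordinate approached from the left, \<open>a i \<le> y i\<close> holds near
  \<open>t i\<close> iff \<open>a i < t i\<close>. If the condition fails, a single failing
  coordinate already keeps all nearby points out of the box, so there is no third case.\<close>

lemma eventually_in_upper_box:
  fixes t :: "'m::finite \<Rightarrow> real"
  assumes tL: "(t, L) \<in> split_cube"
  shows "eventually (\<lambda>y. y \<in> upper_box a) (orthant_filter t L) \<longleftrightarrow>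
      (\<forall>i. if i \<in> L then a i < t i else a i \<le> t i)" (is "_ \<longleftrightarrow> ?R")
    and "eventually (\<lambda>y. y \<in> upper_box a) (orthant_filter t L) \<or>
      eventually (\<lambda>y. y \<notin> upper_box a) (orthant_filter t L)"
proof -
  have 1: "eventually (\<lambda>y. y \<in> upper_box a) (orthant_filter t L)" if ?R
  proof -
    \<comment> \<open>The smallest gap over the left coordinates; the added 1 keeps the minimum
      defined for empty \<open>L\<close>.\<close>
    let ?e = "Min (insert 1 ((\<lambda>i. t i - a i) ` L))"
    have "eventually (\<lambda>y. \<forall>i. a i \<le> y i) (orthant_filter t L)"
      unfolding eventually_orthant_filter
    proof (intro exI conjI ballI impI allI)
      have "a i < t i" if "i \<in> L" for i using \<open>?R\<close>[rule_format, of i] that by simp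
      then show "0 < ?e" by simp
      fix y i assume y: "y \<in> orthant t L" "\<forall>i. \<bar>y i - t i\<bar> < ?e"
      show "a i \<le> y i"
      proof (cases "i \<in> L")
        case True
        then have "?e \<le> t i - a i" by (intro Min_le) auto
        with y(2)[rule_format, of i] show ?thesis by linarith
      next
        case False
        then have "a i \<le> t i" "t i \<le> y i"
          using \<open>?R\<close>[rule_format, of i] y(1)[unfolded orthant_iff, rule_format, of i] by simp_all
        then show ?thesis by simp
      qed
    qed
    then show ?thesis
      using eventually_in_unit_cube[OF tL] by eventually_elim (simp add: upper_box_def)
  qed
  have 2: "eventually (\<lambda>y. y \<notin> upper_box a) (orthant_filter t L)" if "\<not> ?R"
  proof -
    from that obtain i where i: "\<not> (if i \<in> L then a i < t i else a i \<le> t i)" by blast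
    \<comment> \<open>For \<open>i \<in> L\<close> failure means \<open>t i \<le> a i\<close>, and
      \<open>y i < t i\<close> suffices at any radius; otherwise the gap \<open>a i - t i\<close> is
      the radius.\<close>
    let ?e = "if i \<in> L then 1 else a i - t i"
    show ?thesis
      unfolding eventually_orthant_filter
    proof (intro exI conjI ballI impI)
      show "0 < ?e" using i by auto
      fix y assume y: "y \<in> orthant t L" "\<forall>i. \<bar>y i - t i\<bar> < ?e"
      have "\<not> a i \<le> y i"
        using i y(1)[unfolded orthant_iff, rule_format, of i] y(2)[rule_format, of i]
        by (simp split: if_splits)
      then show "y \<notin> upper_box a" by (auto simp: upper_box_def)
    qed
  qed
  show "eventually (\<lambda>y. y \<in> upper_box a) (orthant_filter t L) \<or>
      eventually (\<lambda>y. y \<notin> upper_box a) (orthant_filter t L)"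
    using 1 2 by blast
  show "eventually (\<lambda>y. y \<in> upper_box a) (orthant_filter t L) \<longleftrightarrow> ?R"
  proof
    assume ev: "eventually (\<lambda>y. y \<in> upper_box a) (orthant_filter t L)"
    show ?R
    proof (rule ccontr)
      assume "\<not> ?R"
      from eventually_conj[OF ev 2[OF this]] orthant_filter_neq_bot[OF tL] show False
        by (simp add: eventually_False)
    qed
  qed (rule 1)
qed

lemma upper_box_regular: "upper_box a \<in> regular_sets"
proof -
  have "upper_box a \<subseteq> unit_cube" by (auto simp: upper_box_def)
  then show ?thesis by (rule regular_setsI) (rule eventually_in_upper_box(2))
qed

section \<open>Step functions and the sets they describe\<close>

definition step_span :: "'m::finite dspace set" where
  "step_span = span (range (\<lambda>a. dindicator (upper_box a)))"

lemma step_span_induct [consumes 1, case_names zero step]: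
  assumes "f \<in> step_span" "P 0"
    "\<And>c a g. P g \<Longrightarrow> P (c *\<^sub>R dindicator (upper_box a) + g)"
  shows "P f"
  using assms(1) unfolding step_span_def
  by (induction rule: span_induct_alt) (use assms(2,3) in auto)

lemma dindicator_upper_box_in_step_span: "dindicator (upper_box a) \<in> step_span"
  unfolding step_span_def by (intro span_base) auto

lemma step_span_add: "f \<in> step_span \<Longrightarrow> g \<in> step_span \<Longrightarrow> f + g \<in> step_span"
  and step_span_diff: "f \<in> step_span \<Longrightarrow> g \<in> step_span \<Longrightarrow> f - g \<in> step_span"
  and step_span_scaleR: "f \<in> step_span \<Longrightarrow> c *\<^sub>R f \<in> step_span"
  and step_span_0: "0 \<in> step_span"
  unfolding step_span_def by (auto intro: span_add span_diff span_scale span_zero)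

lemma dmult_add_left: "dmult (f + g) h = dmult f h + dmult g h"
  and dmult_scaleR_left: "dmult (c *\<^sub>R f) h = c *\<^sub>R dmult f h"
  and dmult_commute: "dmult f g = dmult g f"
  and dmult_0_left: "dmult 0 h = 0"
  by (transfer; simp add: algebra_simps)+

lemma dmult_dindicator:
  assumes "E \<in> regular_sets" "F \<in> regular_sets"
  shows "dmult (dindicator E) (dindicator F) = dindicator (E \<inter> F)"
  by (rule dspace_eqI)
    (simp add: dmult.rep_eq dapply_dindicator assms regular_sets_Int indicator_inter_arith)

lemma upper_box_Int: "upper_box a \<inter> upper_box b = upper_box (\<lambda>i. max (a i) (b i))"
  by (auto simp: upper_box_def)

text \<open>Upper boxes are closed under intersection, the corners being combined by
  \<open>max\<close>, so the span of their indicators is a subalgebra.\<close>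

lemma dmult_in_step_span:
  assumes "f \<in> step_span" "g \<in> step_span"
  shows "dmult f g \<in> step_span"
  using assms(1)
proof (induction rule: step_span_induct)
  case zero
  then show ?case by (simp add: dmult_0_left step_span_0)
next
  case (step c a f)
  have "dmult g (dindicator (upper_box a)) \<in> step_span"
    using assms(2)
  proof (induction rule: step_span_induct)
    case zero
    then show ?case by (simp add: dmult_0_left step_span_0)
  next
    case (step d b g)
    then show ?case
      by (simp add: dmult_add_left dmult_scaleR_left dmult_dindicator upper_box_regular upper_box_Int
          step_span_add step_span_scaleR dindicator_upper_box_in_step_span)
  qed
  then show ?case
    using step
    by (simp add: dmult_add_left dmult_scaleR_left dmult_commute[of "dindicator _"]
        step_span_add step_span_scaleR)
qed

text \<open>Boolean operations on these sets correspond to products and differences in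
  \<open>step_span\<close>. This is what allows approximations found locally to be cut off and
  glued.\<close>

definition step_sets :: "('m::finite \<Rightarrow> real) set set" where
  "step_sets = {E \<in> regular_sets. dindicator E \<in> step_span}"

lemma step_sets_upper_box: "upper_box a \<in> step_sets"
  by (simp add: step_sets_def upper_box_regular dindicator_upper_box_in_step_span)

lemma step_sets_unit_cube: "unit_cube \<in> step_sets"
proof -
  have "unit_cube = upper_box (\<lambda>_. 0)" by (auto simp: upper_box_def unit_cube_iff)
  then show ?thesis using step_sets_upper_box by metis
qed

lemma unit_cube_regular: "unit_cube \<in> regular_sets"
  and dindicator_unit_cube_in_step_span: "dindicator unit_cube \<in> step_span"
  using step_sets_unit_cube unfolding step_sets_def by blast+

lemma step_sets_Int: "E \<in> step_sets \<Longrightarrow> F \<in> step_sets \<Longrightarrow> E \<inter> F \<in> step_sets"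
  unfolding step_sets_def by (simp add: regular_sets_Int dmult_in_step_span dmult_dindicator[symmetric])

lemma step_sets_Diff:
  assumes "E \<in> step_sets" "F \<in> step_sets"
  shows "E - F \<in> step_sets"
proof -
  have r: "E \<in> regular_sets" "F \<in> regular_sets" using assms by (auto simp: step_sets_def)
  have eq: "E - F = E \<inter> (unit_cube - F)" using r by (auto simp: regular_sets_def)
  have reg: "E - F \<in> regular_sets" unfolding eq by (intro regular_sets_Int regular_sets_Compl r)
  have "dindicator (E - F) = dindicator E - dmult (dindicator E) (dindicator F)"
    by (rule dspace_eqI)
      (auto simp: minus_dspace.rep_eq dmult.rep_eq dapply_dindicator r reg indicator_def)
  then show ?thesis
    using assms reg by (simp add: step_sets_def step_span_diff dmult_in_step_span)
qed

lemma step_sets_Un: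
  assumes "E \<in> step_sets" "F \<in> step_sets"
  shows "E \<union> F \<in> step_sets"
proof -
  have "E \<union> F = unit_cube - (unit_cube - E) \<inter> (unit_cube - F)"
    using assms by (auto simp: step_sets_def regular_sets_def)
  then show ?thesis using assms by (simp add: step_sets_Int step_sets_Diff step_sets_unit_cube)
qed

lemma step_sets_halfspace: "{y \<in> unit_cube. a \<le> y i} \<in> step_sets"
proof -
  have "{y \<in> unit_cube. a \<le> y i} = upper_box (\<lambda>j. if j = i then a else 0)"
    by (auto simp: upper_box_def unit_cube_iff)
  then show ?thesis using step_sets_upper_box by metis
qed

lemma step_sets_INT:
  assumes "finite I" "\<And>i. i \<in> I \<Longrightarrow> E i \<in> step_sets"
  shows "{y \<in> unit_cube. \<forall>i\<in>I. y \<in> E i} \<in> step_sets"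
  using assms
proof (induction rule: finite_induct)
  case empty
  then show ?case by (simp add: step_sets_unit_cube)
next
  case (insert i I)
  have "{y \<in> unit_cube. \<forall>j\<in>insert i I. y \<in> E j} = E i \<inter> {y \<in> unit_cube. \<forall>j\<in>I. y \<in> E j}"
    using insert.prems[of i] by (auto simp: step_sets_def regular_sets_def)
  then show ?case using insert by (simp add: step_sets_Int)
qed

text \<open>The box is half-open because its building blocks are the half-spaces
  \<open>a \<le> y i\<close> and their complements.\<close>

lemma step_sets_orthant_box:
  fixes t :: "'m::finite \<Rightarrow> real"
  assumes t: "t \<in> unit_cube"
  shows "{y \<in> orthant t L. \<forall>i. t i - e \<le> y i \<and> y i < t i + e} \<in> step_sets"
proof -
  define E where "E i = {y \<in> unit_cube. t i - e \<le> y i} - {y \<in> unit_cube. t i + e \<le> y i}" for i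
  define F where "F i = (if i \<in> L then unit_cube - {y \<in> unit_cube. t i \<le> y i} else {y \<in> unit_cube. t i \<le> y i})" for i
  have "{y \<in> orthant t L. \<forall>i. t i - e \<le> y i \<and> y i < t i + e} = {y \<in> unit_cube. \<forall>i\<in>UNIV. y \<in> E i \<inter> F i}"
  proof (intro set_eqI iffI)
    fix y assume y: "y \<in> {y \<in> orthant t L. \<forall>i. t i - e \<le> y i \<and> y i < t i + e}"
    then have "y \<in> unit_cube" using orthant_subset_unit_cube[OF t] by auto
    with y show "y \<in> {y \<in> unit_cube. \<forall>i\<in>UNIV. y \<in> E i \<inter> F i}"
      by (auto simp: orthant_iff E_def F_def not_le)
  next
    fix y assume y: "y \<in> {y \<in> unit_cube. \<forall>i\<in>UNIV. y \<in> E i \<inter> F i}"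
    then have EF: "y \<in> E i" "y \<in> F i" and uc: "y \<in> unit_cube" for i by auto
    have "if i \<in> L then y i < t i else t i \<le> y i" "t i - e \<le> y i \<and> y i < t i + e" for i
      using EF[of i] uc by (auto simp: E_def F_def not_le split: if_splits)
    then show "y \<in> {y \<in> orthant t L. \<forall>i. t i - e \<le> y i \<and> y i < t i + e}"
      using uc by (simp add: orthant_iff unit_cube_iff)
  qed
  also have "\<dots> \<in> step_sets"
    unfolding E_def F_def
    by (intro step_sets_INT) (auto intro!: step_sets_Int step_sets_Diff step_sets_halfspace step_sets_unit_cube)
  finally show ?thesis .
qed

text \<open>Near \<open>t\<close> the function is within \<open>e\<close> of the constant
  \<open>orthant_lim f t L\<close> on each orthant, and finitely many orthants cover a
  neighbourhood. Compactness of the cube leaves finitely many local approximations to be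
  glued.\<close>

lemma step_span_dense:
  fixes f :: "'m::finite dspace"
  assumes e: "0 < e"
  shows "\<exists>g\<in>step_span. norm (f - g) \<le> e"
proof -
  define good where "good = {E \<in> step_sets. \<exists>g\<in>step_span. \<forall>y\<in>E. \<bar>dapply f y - dapply g y\<bar> \<le> e}"
  have good_empty: "{} \<in> good"
    using step_sets_Diff[OF step_sets_unit_cube step_sets_unit_cube] step_span_0
    by (auto simp: good_def)
  have good_Un: "E \<union> F \<in> good" if E: "E \<in> good" and F: "F \<in> good" for E F
  proof -
    obtain g where g: "g \<in> step_span" "\<forall>y\<in>E. \<bar>dapply f y - dapply g y\<bar> \<le> e"
      using E by (auto simp: good_def)
    obtain h where h: "h \<in> step_span" "\<forall>y\<in>F. \<bar>dapply f y - dapply h y\<bar> \<le> e"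
      using F by (auto simp: good_def)
    have st: "E \<in> step_sets" "F - E \<in> step_sets" "E \<union> F \<in> step_sets"
      using E F by (auto simp: good_def step_sets_Diff step_sets_Un)
    \<comment> \<open>Removing the overlap \<open>E\<close> from \<open>F\<close> makes every point
      use exactly one of the two approximations, so the tolerance stays \<open>e\<close> under
      gluing.\<close>
    let ?k = "dmult g (dindicator E) + dmult h (dindicator (F - E))"
    have "?k \<in> step_span"
      using st g(1) h(1) by (auto simp: step_sets_def intro!: step_span_add dmult_in_step_span)
    moreover have "\<bar>dapply f y - dapply ?k y\<bar> \<le> e" if "y \<in> E \<union> F" for y
      using that st g(2) h(2)
      by (cases "y \<in> E") (auto simp: plus_dspace.rep_eq dmult.rep_eq dapply_dindicator step_sets_def)
    ultimately show ?thesis using st(3) by (auto simp: good_def)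
  qed
  have good_UN: "(\<Union>i\<in>I. E i) \<in> good" if "finite I" "\<And>i. i \<in> I \<Longrightarrow> E i \<in> good" for I :: "'b set" and E
    using that by (induction rule: finite_induct) (auto simp: good_empty good_Un)
  have "\<exists>U G. open U \<and> t \<in> U \<and> G \<in> good \<and> U \<inter> unit_cube \<subseteq> G" if t: "t \<in> unit_cube" for t
  proof -
    define LL where "LL = {L. (t, L) \<in> split_cube}"
    have "\<exists>d>0. \<forall>y\<in>orthant t L. (\<forall>i. \<bar>y i - t i\<bar> < d) \<longrightarrow> \<bar>dapply f y - orthant_lim f t L\<bar> < e"
      if "L \<in> LL" for L
    proof -
      have "eventually (\<lambda>y. \<bar>dapply f y - orthant_lim f t L\<bar> < e) (orthant_filter t L)"
        using tendstoD[OF orthant_lim_tendsto[of t L f] e] that by (simp add: dist_real_def LL_def)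
      then show ?thesis unfolding eventually_orthant_filter .
    qed
    then obtain d where d: "\<And>L. L \<in> LL \<Longrightarrow> 0 < d L"
      and fd: "\<And>L y. L \<in> LL \<Longrightarrow> y \<in> orthant t L \<Longrightarrow> (\<And>i. \<bar>y i - t i\<bar> < d L)
          \<Longrightarrow> \<bar>dapply f y - orthant_lim f t L\<bar> < e"
      by metis
    \<comment> \<open>Halving the radius puts the closed lower end strictly inside the region where
      the approximation is valid.\<close>
    define G where "G L = {y \<in> orthant t L. \<forall>i. t i - d L / 2 \<le> y i \<and> y i < t i + d L / 2}" for L
    have "G L \<in> good" if L: "L \<in> LL" for L
    proof -
      have "G L \<in> step_sets" unfolding G_def by (rule step_sets_orthant_box[OF t])
      moreover have "orthant_lim f t L *\<^sub>R (dindicator unit_cube :: 'm dspace) \<in> step_span"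
        by (intro step_span_scaleR dindicator_unit_cube_in_step_span)
      moreover have "\<bar>dapply f y - dapply (orthant_lim f t L *\<^sub>R dindicator unit_cube) y\<bar> \<le> e"
        if y: "y \<in> G L" for y
      proof -
        have "\<bar>y i - t i\<bar> < d L" for i
        proof -
          have "t i - d L / 2 \<le> y i" "y i < t i + d L / 2" using y by (auto simp: G_def)
          then show ?thesis using d[OF L] by linarith
        qed
        then have "\<bar>dapply f y - orthant_lim f t L\<bar> < e" using y by (intro fd[OF L]) (auto simp: G_def)
        moreover have "y \<in> unit_cube" using y orthant_subset_unit_cube[OF t, of L] by (auto simp: G_def)
        ultimately show ?thesis
          by (simp add: scaleR_dspace.rep_eq dapply_dindicator unit_cube_regular)
      qed
      ultimately show ?thesis by (auto simp: good_def)
    qed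
    then have "(\<Union>L\<in>LL. G L) \<in> good" by (intro good_UN) auto
    \<comment> \<open>All admissible \<open>L\<close> are needed at once: a point \<open>y\<close>
      of \<open>U\<close> lies in the orthant given by the coordinates in which \<open>y\<close> is
      below \<open>t\<close>, and these vary over \<open>U\<close>.\<close>
    moreover define U where "U = (\<Inter>L\<in>LL. {y. \<forall>i. \<bar>y i - t i\<bar> < d L / 2})"
    have "open U" unfolding U_def by (intro open_INT ballI open_box) auto
    moreover have "t \<in> U" using d by (auto simp: U_def)
    moreover have "U \<inter> unit_cube \<subseteq> (\<Union>L\<in>LL. G L)"
    proof
      fix y assume y: "y \<in> U \<inter> unit_cube"
      let ?L = "{i. y i < t i}"
      have L: "?L \<in> LL" using y t by (simp add: LL_def split_cubeI_less)
      have "t i - d ?L / 2 \<le> y i \<and> y i < t i + d ?L / 2" for i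
      proof -
        have "\<bar>y i - t i\<bar> < d ?L / 2" using y L by (auto simp: U_def)
        then show ?thesis by linarith
      qed
      then have "y \<in> G ?L" using y by (auto simp: G_def in_orthantI)
      then show "y \<in> (\<Union>L\<in>LL. G L)" using L by blast
    qed
    ultimately show ?thesis by blast
  qed
  then obtain U G where U: "\<And>t. t \<in> unit_cube \<Longrightarrow> open (U t)" "\<And>t. t \<in> unit_cube \<Longrightarrow> t \<in> U t"
    and G: "\<And>t. t \<in> unit_cube \<Longrightarrow> G t \<in> good" "\<And>t. t \<in> unit_cube \<Longrightarrow> U t \<inter> unit_cube \<subseteq> G t"
    by metis
  obtain C where C: "C \<subseteq> unit_cube" "finite C" "unit_cube \<subseteq> (\<Union>t\<in>C. U t)"
    by (rule compactE_image[OF compact_unit_cube, of unit_cube U]) (use U in auto)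
  have "(\<Union>t\<in>C. G t) \<in> good" using C G by (intro good_UN) auto
  then obtain g where g: "g \<in> step_span" "\<forall>y\<in>(\<Union>t\<in>C. G t). \<bar>dapply f y - dapply g y\<bar> \<le> e"
    by (auto simp: good_def)
  have "unit_cube \<subseteq> (\<Union>t\<in>C. G t)" using C G(2) by blast
  then have "norm (f - g) \<le> e" using g(2) by (intro norm_dspace_leI) (auto simp: minus_dspace.rep_eq)
  then show ?thesis using g(1) by blast
qed

lemma step_span_LIMSEQ:
  fixes f :: "'m::finite dspace"
  obtains g where "\<And>n. g n \<in> step_span" "g \<longlonglongrightarrow> f"
proof -
  have "\<forall>n. \<exists>g\<in>step_span. norm (f - g) \<le> inverse (real (Suc n))" 
    by (intro allI step_span_dense) simp
  then obtain g where g: "\<And>n. g n \<in> step_span" "\<And>n. norm (f - g n) \<le> inverse (real (Suc n))" by metis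
  have "(\<lambda>n. norm (g n - f)) \<longlonglongrightarrow> 0"
    by (rule tendsto_sandwich[OF _ _ tendsto_const LIMSEQ_inverse_real_of_nat])
      (use g(2) in \<open>auto simp: norm_minus_commute\<close>)
  then have "g \<longlonglongrightarrow> f" by (simp add: tendsto_norm_zero_iff LIM_zero_iff)
  with g(1) show ?thesis by (rule that)
qed

lemma bounded_linear_eq_on_upper_boxes:
  fixes \<phi> \<psi> :: "'m::finite dspace \<Rightarrow> real"
  assumes \<phi>: "bounded_linear \<phi>" and \<psi>: "bounded_linear \<psi>"
    and eq: "\<And>a. \<phi> (dindicator (upper_box a)) = \<psi> (dindicator (upper_box a))"
  shows "\<phi> f = \<psi> f"
proof -
  have *: "\<phi> g = \<psi> g" if "g \<in> step_span" for g
    using that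
    by (induction rule: step_span_induct)
      (simp_all add: eq linear_simps[OF \<phi>] linear_simps[OF \<psi>])
  obtain g where g: "\<And>n. g n \<in> step_span" "g \<longlonglongrightarrow> f" using step_span_LIMSEQ[of f] by blast
  have "(\<lambda>n. \<phi> (g n)) \<longlonglongrightarrow> \<phi> f" "(\<lambda>n. \<psi> (g n)) \<longlonglongrightarrow> \<psi> f"
    using bounded_linear.tendsto[OF \<phi> g(2)] bounded_linear.tendsto[OF \<psi> g(2)] by auto
  then show ?thesis using *[OF g(1)] LIMSEQ_unique by simp
qed

subsection \<open>Slices of functions in $D$\<close>

lemma prod_of_bool:
  "finite A \<Longrightarrow> (\<Prod>i\<in>A. of_bool (P i) :: real) = of_bool (\<forall>i\<in>A. P i)"
  by (induction rule: finite_induct) auto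

lemma prod_diff_eq_alternating_sum:
  fixes u v :: "'a \<Rightarrow> real"
  assumes "finite J"
  shows "(\<Prod>i\<in>J. u i - v i) = (\<Sum>L\<in>Pow J. (-1) ^ card L * ((\<Prod>i\<in>L. v i) * (\<Prod>i\<in>J - L. u i)))"
  using prod_add[OF assms, of "\<lambda>i. - v i" u] by (simp add: prod_uminus mult.assoc)

definition upper_face :: "'m set \<Rightarrow> ('m \<Rightarrow> real) \<Rightarrow> ('m \<Rightarrow> real) set" where
  "upper_face K a = {x \<in> space (cube_space K). \<forall>i\<in>K. a i \<le> x i}"

lemma measurable_cube_space_component [measurable]:
  "i \<in> K \<Longrightarrow> (\<lambda>x. x i) \<in> borel_measurable (cube_space K)"
  unfolding cube_space_def
  by (rule measurable_compose[OF measurable_component_singleton]) (auto intro: measurable_restrict_space1)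

lemma upper_face_sets [measurable]:
  fixes a :: "'m::finite \<Rightarrow> real"
  shows "upper_face K a \<in> sets (cube_space K)"
  unfolding upper_face_def by measurable

text \<open>The indicator of an upper box is a product over the coordinates. In a coordinate of
  \<open>J\<close> the factor jumps by 1[a_i \<le> t_i] - 1[a_i < t_i], which is 1[t_i = a_i]; in
  the others it is left alone. Hence at most one tuple \<open>s\<close> sees the box.\<close>

lemma slice_upper_box:
  fixes a :: "'m::{finite,linorder} \<Rightarrow> real"
  assumes s: "s \<in> J \<rightarrow>\<^sub>E {0<..1}" and x: "x \<in> space (cube_space (- J))"
  shows "slice J (dindicator (upper_box a)) s x =
    of_bool (\<forall>j\<in>J. s j = a j) * indicator (upper_face (- J) a) x"
proof -
  define t where "t = merge J (- J) (s, x)"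
  define u v :: "'m \<Rightarrow> real" where "u i = of_bool (a i \<le> t i)" and "v i = of_bool (a i < t i)" for i
  have lim: "orthant_lim (dindicator (upper_box a)) t L =
      (\<Prod>i\<in>L. v i) * (\<Prod>i\<in>J - L. u i) * (\<Prod>i\<in>- J. u i)" if L: "L \<in> Pow J" for L
  proof -
    have tL: "(t, L) \<in> split_cube" unfolding t_def using merge_in_split_cube[OF s x] L by auto
    have "orthant_lim (dindicator (upper_box a)) t L = of_bool (\<forall>i. if i \<in> L then a i < t i else a i \<le> t i)"
      by (simp only: orthant_lim_dindicator[OF upper_box_regular tL] eventually_in_upper_box(1)[OF tL])
    also have "\<dots> = of_bool ((\<forall>i\<in>L. a i < t i) \<and> (\<forall>i\<in>J - L. a i \<le> t i) \<and> (\<forall>i\<in>- J. a i \<le> t i))"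
      using L by (intro arg_cong[of _ _ of_bool]) (auto split: if_splits)
    finally show ?thesis by (simp add: u_def v_def prod_of_bool of_bool_conj)
  qed
  have "slice J (dindicator (upper_box a)) s x = (\<Prod>i\<in>J. u i - v i) * (\<Prod>i\<in>- J. u i)"
    unfolding slice_eq[OF s x] t_def[symmetric] prod_diff_eq_alternating_sum[OF finite] sum_distrib_right
    by (intro sum.cong refl) (simp add: lim mult.assoc)
  also have "(\<Prod>i\<in>J. u i - v i) = (\<Prod>i\<in>J. of_bool (s i = a i))"
    by (intro prod.cong refl) (auto simp: u_def v_def t_def merge_def)
  also have "(\<Prod>i\<in>- J. u i) = (\<Prod>i\<in>- J. of_bool (a i \<le> x i))"
    by (intro prod.cong refl) (auto simp: u_def t_def merge_def)
  also have "\<dots> = indicator (upper_face (- J) a) x"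
    using x by (simp add: prod_of_bool upper_face_def indicator_def)
  finally show ?thesis by (simp add: prod_of_bool)
qed

lemma slice_zero:
  "s \<in> J \<rightarrow>\<^sub>E {0<..1} \<Longrightarrow> x \<in> space (cube_space (- J)) \<Longrightarrow> slice J 0 s x = 0"
  using slice_scaleR[of s J x 0 0] by simp

text \<open>Slices of step functions are combinations of indicators of upper faces, and by
  \<open>slice_bound\<close> convergence in norm entails pointwise convergence of the
  slices.\<close>

lemma slice_measurable:
  fixes f :: "'m::{finite,linorder} dspace"
  assumes s: "s \<in> J \<rightarrow>\<^sub>E {0<..1}"
  shows "slice J f s \<in> borel_measurable (cube_space (- J))"
proof -
  have *: "slice J g s \<in> borel_measurable (cube_space (- J))" if "g \<in> step_span" for g
    using that
  proof (induction rule: step_span_induct)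
    case zero
    have "(\<lambda>x. 0 :: real) \<in> borel_measurable (cube_space (- J))" by simp
    then show ?case by (rule measurable_cong[THEN iffD1, rotated]) (simp add: slice_zero[OF s])
  next
    case (step c a g)
    have "(\<lambda>x. c * (of_bool (\<forall>j\<in>J. s j = a j) * indicator (upper_face (- J) a) x) + slice J g s x)
        \<in> borel_measurable (cube_space (- J))"
      by (intro borel_measurable_add borel_measurable_times borel_measurable_const
          borel_measurable_indicator upper_face_sets step)
    then show ?case
      by (rule measurable_cong[THEN iffD1, rotated])
        (simp add: slice_add[OF s] slice_scaleR[OF s] slice_upper_box[OF s])
  qed
  obtain g where g: "\<And>n. g n \<in> step_span" "g \<longlonglongrightarrow> f" using step_span_LIMSEQ[of f] by blast
  show ?thesis
  proof (rule borel_measurable_LIMSEQ_real)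
    show "slice J (g n) s \<in> borel_measurable (cube_space (- J))" for n by (rule * g)+
    fix x assume x: "x \<in> space (cube_space (- J))"
    have "bounded_linear (\<lambda>f. slice J f s x)"
      using slice_bound[OF s x]
      by (intro bounded_linear_intro[of _ "2 ^ card J"]) (auto simp: slice_add[OF s x] slice_scaleR[OF s x] mult.commute)
    from bounded_linear.tendsto[OF this g(2)] show "(\<lambda>n. slice J (g n) s x) \<longlonglongrightarrow> slice J f s x" .
  qed
qed

subsection \<open>The functional defined by an admissible family\<close>

locale admissible_family =
  fixes \<mu> :: "'m::{finite,linorder} measure_family"
  assumes admissible: "admissible \<mu>"
begin

lemma total_variation_sum_le:
  assumes "finite F" "F \<subseteq> J \<rightarrow>\<^sub>E {0<..1}"
  shows "(\<Sum>s\<in>F. total_variation (cube_space (- J)) (\<mu> J s)) \<le> family_norm \<mu> J"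
  unfolding family_norm_def using assms
  by (subst nonneg_infsum_complete) (auto intro!: SUP_upper)

lemma finite_signed_measure:
  assumes "s \<in> J \<rightarrow>\<^sub>E {0<..1}"
  shows "finite_signed_measure (cube_space (- J)) (\<mu> J s)"
proof
  show "signed_measure (cube_space (- J)) (\<mu> J s)"
    using admissible assms by (auto simp: admissible_def)
  have "total_variation (cube_space (- J)) (\<mu> J s) \<le> family_norm \<mu> J"
    using total_variation_sum_le[of "{s}" J] assms by auto
  also have "\<dots> < \<infinity>" using admissible by (simp add: admissible_def)
  finally show "total_variation (cube_space (- J)) (\<mu> J s) < \<infinity>" .
qed

definition variation :: "'m set \<Rightarrow> ('m \<Rightarrow> real) \<Rightarrow> real" where
  "variation J s = enn2real (total_variation (cube_space (- J)) (\<mu> J s))"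

lemma ennreal_variation:
  "s \<in> J \<rightarrow>\<^sub>E {0<..1} \<Longrightarrow> ennreal (variation J s) = total_variation (cube_space (- J)) (\<mu> J s)"
  using finite_signed_measure.finite_variation[OF finite_signed_measure, of s J]
  by (simp add: variation_def less_top)

lemma variation_sum_le:
  assumes F: "finite F" "F \<subseteq> J \<rightarrow>\<^sub>E {0<..1}"
  shows "sum (variation J) F \<le> enn2real (family_norm \<mu> J)"
proof -
  have "ennreal (sum (variation J) F) = (\<Sum>s\<in>F. ennreal (variation J s))"
    by (subst sum_ennreal) (auto simp: variation_def)
  also have "\<dots> = (\<Sum>s\<in>F. total_variation (cube_space (- J)) (\<mu> J s))"
    using F by (intro sum.cong refl ennreal_variation) auto
  also have "\<dots> \<le> family_norm \<mu> J" by (rule total_variation_sum_le[OF F])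
  finally have "enn2real (ennreal (sum (variation J) F)) \<le> enn2real (family_norm \<mu> J)"
    using admissible by (intro enn2real_mono) (auto simp: admissible_def)
  then show ?thesis by (simp add: sum_nonneg variation_def)
qed

lemma variation_summable: "variation J summable_on (J \<rightarrow>\<^sub>E {0<..1})"
proof (rule nonneg_bdd_above_summable_on)
  show "bdd_above (sum (variation J) ` {F. F \<subseteq> J \<rightarrow>\<^sub>E {0<..1} \<and> finite F})"
    using variation_sum_le by (intro bdd_aboveI2) auto
qed (simp add: variation_def)

lemma variation_infsum_le: "infsum (variation J) (J \<rightarrow>\<^sub>E {0<..1}) \<le> enn2real (family_norm \<mu> J)"
  by (intro infsum_le_finite_sums variation_summable variation_sum_le)

abbreviation term_integral :: "'m set \<Rightarrow> 'm dspace \<Rightarrow> ('m \<Rightarrow> real) \<Rightarrow> real" where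
  "term_integral J f s \<equiv> signed_integral (cube_space (- J)) (\<mu> J s) (slice J f s)"

lemma slice_signed_integrable:
  "s \<in> J \<rightarrow>\<^sub>E {0<..1} \<Longrightarrow> signed_integrable (cube_space (- J)) (\<mu> J s) (slice J f s)"
  by (rule finite_signed_measure.signed_integrableI[OF finite_signed_measure slice_measurable slice_bound])

lemma term_integral_bound:
  "s \<in> J \<rightarrow>\<^sub>E {0<..1} \<Longrightarrow> \<bar>term_integral J f s\<bar> \<le> 2 ^ card J * norm f * variation J s"
  unfolding variation_def
  by (rule finite_signed_measure.signed_integral_bound[OF finite_signed_measure slice_measurable slice_bound])
    auto

lemma term_integral_summable: "term_integral J f summable_on (J \<rightarrow>\<^sub>E {0<..1})"
proof (rule Infinite_Sum.abs_summable_summable)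
  have "(\<lambda>s. 2 ^ card J * norm f * variation J s) summable_on (J \<rightarrow>\<^sub>E {0<..1})"
    by (intro summable_on_cmult_right variation_summable)
  then show "(\<lambda>s. norm (term_integral J f s)) summable_on (J \<rightarrow>\<^sub>E {0<..1})"
    by (rule Infinite_Sum.abs_summable_on_comparison_test') (simp add: term_integral_bound)
qed

lemma chi_part_converges: "chi_part_converges \<mu> J f"
  unfolding chi_part_converges_def by (auto intro: slice_signed_integrable term_integral_summable)

lemma chi_part_bound: "\<bar>chi_part \<mu> J f\<bar> \<le> 2 ^ card J * norm f * enn2real (family_norm \<mu> J)"
proof -
  have "\<bar>chi_part \<mu> J f\<bar> \<le> infsum (\<lambda>s. 2 ^ card J * norm f * variation J s) (J \<rightarrow>\<^sub>E {0<..1})"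
    unfolding chi_part_def real_norm_def[symmetric]
    by (rule norm_infsum_le[OF has_sum_infsum has_sum_infsum, OF term_integral_summable summable_on_cmult_right, OF variation_summable])
      (simp add: term_integral_bound)
  also have "\<dots> = 2 ^ card J * norm f * infsum (variation J) (J \<rightarrow>\<^sub>E {0<..1})"
    by (rule infsum_cmult_right')
  also have "\<dots> \<le> 2 ^ card J * norm f * enn2real (family_norm \<mu> J)"
    by (intro mult_left_mono variation_infsum_le) auto
  finally show ?thesis .
qed

lemma chi_part_bounded_linear: "bounded_linear (chi_part \<mu> J)"
proof (rule bounded_linear_intro)
  fix f g :: "'m dspace" and c :: real
  have "term_integral J (f + g) s = term_integral J f s + term_integral J g s"
    if s: "s \<in> J \<rightarrow>\<^sub>E {0<..1}" for s
    unfolding signed_integral_add[OF slice_signed_integrable[OF s] slice_signed_integrable[OF s], symmetric]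
    by (rule finite_signed_measure.signed_integral_cong[OF finite_signed_measure[OF s]]) (rule slice_add[OF s])
  then have "chi_part \<mu> J (f + g) = infsum (\<lambda>s. term_integral J f s + term_integral J g s) (J \<rightarrow>\<^sub>E {0<..1})"
    unfolding chi_part_def by (rule infsum_cong)
  also have "\<dots> = chi_part \<mu> J f + chi_part \<mu> J g"
    unfolding chi_part_def by (intro infsum_add term_integral_summable)
  finally show "chi_part \<mu> J (f + g) = chi_part \<mu> J f + chi_part \<mu> J g" .
  have "term_integral J (c *\<^sub>R f) s = c * term_integral J f s" if s: "s \<in> J \<rightarrow>\<^sub>E {0<..1}" for s
    unfolding signed_integral_cmult[symmetric]
    by (rule finite_signed_measure.signed_integral_cong[OF finite_signed_measure[OF s]]) (rule slice_scaleR[OF s])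
  then have "chi_part \<mu> J (c *\<^sub>R f) = infsum (\<lambda>s. c * term_integral J f s) (J \<rightarrow>\<^sub>E {0<..1})"
    unfolding chi_part_def by (rule infsum_cong)
  then show "chi_part \<mu> J (c *\<^sub>R f) = c *\<^sub>R chi_part \<mu> J f"
    unfolding chi_part_def by (simp add: infsum_cmult_right')
  show "norm (chi_part \<mu> J f) \<le> norm f * (2 ^ card J * enn2real (family_norm \<mu> J))"
    using chi_part_bound[of J f] by (simp add: mult_ac)
qed

lemma chi_bounded_linear: "bounded_linear (\<lambda>f. \<Sum>J\<in>UNIV. chi_part \<mu> J f)"
  by (intro bounded_linear_sum chi_part_bounded_linear)

lemma chi_bound:
  "\<bar>\<Sum>J\<in>UNIV. chi_part \<mu> J f\<bar> \<le> 2 ^ CARD('m) * enn2real (\<Sum>J\<in>UNIV. family_norm \<mu> J) * norm f"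
proof -
  have "\<bar>\<Sum>J\<in>UNIV. chi_part \<mu> J f\<bar> \<le> (\<Sum>J\<in>UNIV. \<bar>chi_part \<mu> J f\<bar>)" by (rule sum_abs)
  also have "\<dots> \<le> (\<Sum>J\<in>UNIV. 2 ^ CARD('m) * norm f * enn2real (family_norm \<mu> J))"
  proof (rule sum_mono)
    fix J :: "'m set"
    have "card J \<le> CARD('m)" by (intro card_mono) auto
    then have "2 ^ card J * norm f * enn2real (family_norm \<mu> J) \<le> 2 ^ CARD('m) * norm f * enn2real (family_norm \<mu> J)"
      by (intro mult_right_mono power_increasing) auto
    with chi_part_bound[of J f] show "\<bar>chi_part \<mu> J f\<bar> \<le> 2 ^ CARD('m) * norm f * enn2real (family_norm \<mu> J)"
      by (rule order_trans)
  qed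
  also have "\<dots> = 2 ^ CARD('m) * norm f * enn2real (\<Sum>J\<in>UNIV. family_norm \<mu> J)"
    using admissible by (subst enn2real_sum) (auto simp: admissible_def sum_distrib_left)
  finally show ?thesis by (simp add: mult_ac)
qed

text \<open>Upper boxes are the test functions that read off the measures: for each \<open>J\<close>
  only the tuple \<open>s = restrict a J\<close> contributes. If some \<open>a j\<close> with
  \<open>j \<in> J\<close> is outside (0,1], that tuple is not among the indices of the sum.\<close>

lemma chi_part_upper_box:
  "chi_part \<mu> J (dindicator (upper_box a)) =
    (if \<forall>j\<in>J. 0 < a j \<and> a j \<le> 1 then \<mu> J (restrict a J) (upper_face (- J) a) else 0)"
proof -
  have term_eq: "term_integral J (dindicator (upper_box a)) s =
      of_bool (s = restrict a J) * \<mu> J s (upper_face (- J) a)" if s: "s \<in> J \<rightarrow>\<^sub>E {0<..1}" for s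
  proof -
    interpret finite_signed_measure "cube_space (- J)" "\<mu> J s" by (rule finite_signed_measure[OF s])
    have eq: "(\<forall>j\<in>J. s j = a j) \<longleftrightarrow> s = restrict a J"
      using s by (auto simp: fun_eq_iff PiE_iff extensional_def)
    have "term_integral J (dindicator (upper_box a)) s = signed_integral (cube_space (- J)) (\<mu> J s)
        (\<lambda>x. of_bool (s = restrict a J) * indicator (upper_face (- J) a) x)"
      by (rule signed_integral_cong) (simp add: slice_upper_box[OF s] eq)
    then show ?thesis by (simp add: signed_integral_cmult signed_integral_indicator upper_face_sets)
  qed
  let ?T = "{restrict a J} \<inter> (J \<rightarrow>\<^sub>E {0<..1})"
  have "chi_part \<mu> J (dindicator (upper_box a)) = infsum (\<lambda>s. \<mu> J s (upper_face (- J) a)) ?T"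
    unfolding chi_part_def
  proof (rule infsum_cong_neutral)
    fix s assume "s \<in> (J \<rightarrow>\<^sub>E {0<..1}) - ?T"
    then have "s \<in> J \<rightarrow>\<^sub>E {0<..1}" "s \<noteq> restrict a J" by blast+
    then show "term_integral J (dindicator (upper_box a)) s = 0" by (simp add: term_eq)
  next
    fix s assume "s \<in> (J \<rightarrow>\<^sub>E {0<..1}) \<inter> ?T"
    then have "s \<in> J \<rightarrow>\<^sub>E {0<..1}" "s = restrict a J" by blast+
    then show "term_integral J (dindicator (upper_box a)) s = \<mu> J s (upper_face (- J) a)"
      by (simp only: term_eq) simp
  qed blast
  also have "\<dots> = (\<Sum>s\<in>?T. \<mu> J s (upper_face (- J) a))" by (rule infsum_finite) simp
  also have "\<dots> = (if restrict a J \<in> J \<rightarrow>\<^sub>E {0<..1} then \<mu> J (restrict a J) (upper_face (- J) a) else 0)"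
    by (cases "restrict a J \<in> J \<rightarrow>\<^sub>E {0<..1}") (simp_all only: Int_insert_left_if1 Int_insert_left_if0, simp_all)
  finally show ?thesis by (simp only: restrict_PiE_iff greaterThanAtMost_iff)
qed

end

subsection \<open>Measures on the split cube\<close>

text \<open>The points where the continuous extension of the indicator of \<open>E\<close> takes the
  value 1. For regular \<open>E\<close> this is a clopen set, and \<open>split_trace\<close>
  recovers \<open>E\<close> from the points \<open>(t, {})\<close>.\<close>

definition split_set :: "('m::finite \<Rightarrow> real) set \<Rightarrow> (('m \<Rightarrow> real) \<times> 'm set) set" where
  "split_set E = {x \<in> split_cube. eventually (\<lambda>y. y \<in> E) (orthant_filter (fst x) (snd x))}"

definition split_algebra :: "(('m::finite \<Rightarrow> real) \<times> 'm set) set set" where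
  "split_algebra = split_set ` regular_sets"

definition split_trace :: "(('m \<Rightarrow> real) \<times> 'm set) set \<Rightarrow> ('m \<Rightarrow> real) set" where
  "split_trace Y = {t. (t, {}) \<in> Y}"

lemma split_set_iff:
  "(t, L) \<in> split_set E \<longleftrightarrow> (t, L) \<in> split_cube \<and> eventually (\<lambda>y. y \<in> E) (orthant_filter t L)"
  by (simp add: split_set_def)

lemma split_set_subset: "split_set E \<subseteq> split_cube"
  by (auto simp: split_set_def)

lemma not_in_split_set:
  assumes "E \<in> regular_sets" "(t, L) \<in> split_cube"
  shows "(t, L) \<notin> split_set E \<longleftrightarrow> eventually (\<lambda>y. y \<notin> E) (orthant_filter t L)"
proof
  assume "(t, L) \<notin> split_set E"
  then show "eventually (\<lambda>y. y \<notin> E) (orthant_filter t L)"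
    using regular_sets_cases[OF assms] assms(2) by (auto simp: split_set_iff)
next
  assume 1: "eventually (\<lambda>y. y \<notin> E) (orthant_filter t L)"
  show "(t, L) \<notin> split_set E"
  proof
    assume "(t, L) \<in> split_set E"
    then have "eventually (\<lambda>y. y \<in> E) (orthant_filter t L)" by (simp add: split_set_iff)
    from eventually_conj[OF 1 this] orthant_filter_neq_bot[OF assms(2)] show False
      by (simp add: eventually_False)
  qed
qed

lemma split_set_empty [simp]: "split_set {} = {}"
  using orthant_filter_neq_bot by (auto simp: split_set_def eventually_False)

lemma split_set_Int: "split_set (E \<inter> F) = split_set E \<inter> split_set F"
  by (auto simp: split_set_def eventually_conj_iff)

lemma split_set_Compl:
  assumes "E \<in> regular_sets"
  shows "split_set (unit_cube - E) = split_cube - split_set E"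
proof (rule set_eqI)
  fix x :: "('a \<Rightarrow> real) \<times> 'a set"
  obtain t L where x: "x = (t, L)" by (cases x)
  show "x \<in> split_set (unit_cube - E) \<longleftrightarrow> x \<in> split_cube - split_set E"
  proof (cases "(t, L) \<in> split_cube")
    case True
    then show ?thesis
      unfolding x by (simp add: not_in_split_set[OF assms True])
        (simp add: split_set_iff eventually_conj_iff eventually_in_unit_cube[OF True])
  qed (auto simp: x split_set_def)
qed

lemma split_trace_split_set:
  assumes E: "E \<in> regular_sets"
  shows "split_trace (split_set E) = E"
proof (rule set_eqI)
  fix t :: "'a \<Rightarrow> real"
  show "t \<in> split_trace (split_set E) \<longleftrightarrow> t \<in> E"
  proof (cases "t \<in> unit_cube")
    case True
    then have tL: "(t, {}) \<in> split_cube" by (simp add: split_cube_def)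
    have "of_bool (eventually (\<lambda>y. y \<in> E) (orthant_filter t {})) = (indicator E t :: real)"
      using orthant_lim_dindicator[OF E tL] orthant_lim_empty[OF True, of "dindicator E"]
      by (simp add: dapply_dindicator E)
    then have "eventually (\<lambda>y. y \<in> E) (orthant_filter t {}) \<longleftrightarrow> t \<in> E"
      by (auto simp: indicator_def split: if_splits)
    then show ?thesis using tL by (simp add: split_trace_def split_set_iff)
  next
    case False
    then show ?thesis using regular_sets_subset[OF E] by (auto simp: split_trace_def split_set_iff split_cube_def)
  qed
qed

lemma split_algebra_cases:
  assumes "Y \<in> split_algebra"
  obtains "split_trace Y \<in> regular_sets" "Y = split_set (split_trace Y)"
proof -
  obtain E where "E \<in> regular_sets" "Y = split_set E" using assms by (auto simp: split_algebra_def)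
  then show ?thesis using that split_trace_split_set[of E] by simp
qed

lemma algebra_split_algebra: "algebra split_cube split_algebra"
  unfolding algebra_iff_Int
proof (intro conjI ballI)
  show "split_algebra \<subseteq> Pow split_cube" using split_set_subset by (auto simp: split_algebra_def)
  show "{} \<in> split_algebra"
    unfolding split_algebra_def using split_set_empty regular_sets_empty by blast
  fix a :: "(('a \<Rightarrow> real) \<times> 'a set) set" assume "a \<in> split_algebra"
  then obtain E where E: "E \<in> regular_sets" "a = split_set E" by (auto simp: split_algebra_def)
  show "split_cube - a \<in> split_algebra"
    using E regular_sets_Compl[OF E(1)] by (auto simp: split_algebra_def split_set_Compl[symmetric])
  fix b :: "(('a \<Rightarrow> real) \<times> 'a set) set" assume "b \<in> split_algebra"
  then obtain F where "F \<in> regular_sets" "b = split_set F" by (auto simp: split_algebra_def)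
  then show "a \<inter> b \<in> split_algebra"
    using E regular_sets_Int by (auto simp: split_algebra_def split_set_Int[symmetric])
qed

text \<open>
  This is compactness of the split cube; it makes every finitely additive positive set function
  on \<^const>\<open>split_algebra\<close> automatically countably additive.
\<close>

lemma split_algebra_decseq_empty:
  fixes A :: "nat \<Rightarrow> (('m::finite \<Rightarrow> real) \<times> 'm set) set"
  assumes A: "range A \<subseteq> split_algebra" and dec: "decseq A" and empty: "(\<Inter>n. A n) = {}"
  shows "\<exists>n. A n = {}"
proof -
  define E where "E n = split_trace (A n)" for n
  have E: "E n \<in> regular_sets" "A n = split_set (E n)" for n
    using A split_algebra_cases[of "A n"] unfolding E_def by blast+
  have E_mono: "E n \<subseteq> E m" if "m \<le> n" for m n
    using decseqD[OF dec that] by (auto simp: E_def split_trace_def)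
  have "\<exists>U n. open U \<and> t \<in> U \<and> U \<inter> E n = {}" if t: "t \<in> unit_cube" for t
  proof -
    define LL where "LL = {L. (t, L) \<in> split_cube}"
    have "\<exists>n d. 0 < d \<and> (\<forall>y\<in>orthant t L. (\<forall>i. \<bar>y i - t i\<bar> < d) \<longrightarrow> y \<notin> E n)" if L: "L \<in> LL" for L
    proof -
      obtain n where "(t, L) \<notin> A n" using empty by blast
      then have "eventually (\<lambda>y. y \<notin> E n) (orthant_filter t L)"
        using not_in_split_set[OF E(1)] L by (simp add: E(2) LL_def)
      then show ?thesis unfolding eventually_orthant_filter by blast
    qed
    then obtain n d where d: "\<And>L. L \<in> LL \<Longrightarrow> 0 < d L"
      and nd: "\<And>L y. L \<in> LL \<Longrightarrow> y \<in> orthant t L \<Longrightarrow> (\<And>i. \<bar>y i - t i\<bar> < d L) \<Longrightarrow> y \<notin> E (n L)"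
      by metis
    define U where "U = (\<Inter>L\<in>LL. {y. \<forall>i. \<bar>y i - t i\<bar> < d L})"
    \<comment> \<open>The sets decrease, so the largest of the finitely many indices serves all
      orthants at \<open>t\<close> simultaneously.\<close>
    define m where "m = Max (n ` LL)"
    have "open U" unfolding U_def by (intro open_INT ballI open_box) auto
    moreover have "t \<in> U" using d by (auto simp: U_def)
    moreover have "y \<notin> E m" if y: "y \<in> U" for y
    proof
      assume ym: "y \<in> E m"
      then have uc: "y \<in> unit_cube" using regular_sets_subset E(1) by blast
      let ?L = "{i. y i < t i}"
      have L: "?L \<in> LL" using uc t by (simp add: LL_def split_cubeI_less)
      then have "n ?L \<le> m" unfolding m_def by (intro Max_ge) auto
      then have "y \<in> E (n ?L)" using E_mono ym by blast
      moreover have "y \<notin> E (n ?L)"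
        using y L by (intro nd in_orthantI uc) (auto simp: U_def)
      ultimately show False by simp
    qed
    ultimately show ?thesis by blast
  qed
  then obtain U n where U: "\<And>t. t \<in> unit_cube \<Longrightarrow> open (U t)" "\<And>t. t \<in> unit_cube \<Longrightarrow> t \<in> U t"
    "\<And>t. t \<in> unit_cube \<Longrightarrow> U t \<inter> E (n t) = {}"
    by metis
  obtain C where C: "C \<subseteq> unit_cube" "finite C" "unit_cube \<subseteq> (\<Union>t\<in>C. U t)"
    by (rule compactE_image[OF compact_unit_cube, of unit_cube U]) (use U in auto)
  have "E (Max (n ` C)) = {}"
  proof (rule equals0I)
    fix y assume y: "y \<in> E (Max (n ` C))"
    then have "y \<in> unit_cube" using regular_sets_subset E(1) by blast
    then obtain t where t: "t \<in> C" "y \<in> U t" using C by blast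
    then have "n t \<le> Max (n ` C)" using C(2) by (intro Max_ge) auto
    then have "y \<in> E (n t)" using E_mono y by blast
    then show False using U(3)[of t] t C(1) by blast
  qed
  then show ?thesis using E(2) split_set_empty by metis
qed

text \<open>\<open>caratheodory_empty_continuous\<close> asks for finite values and continuity at
  the empty set. The variation is a real number, and by \<open>split_algebra_decseq_empty\<close> a
  decreasing sequence with empty intersection is empty from some index on.\<close>

lemma charge_extension:
  fixes l :: "(('m::finite \<Rightarrow> real) \<times> 'm set) set \<Rightarrow> real"
  assumes "charge split_cube split_algebra l"
  obtains N where "finite_measure N" "space N = split_cube" "sets N = sigma_sets split_cube split_algebra"
    "\<And>Y. Y \<in> split_algebra \<Longrightarrow> measure N Y = upper_variation split_algebra l Y"
proof -
  interpret charge split_cube split_algebra l by fact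
  let ?p = "\<lambda>Y. ennreal (upper_variation split_algebra l Y)"
  have "\<exists>\<mu>. (\<forall>Y\<in>split_algebra. \<mu> Y = ?p Y) \<and> measure_space split_cube (sigma_sets split_cube split_algebra) \<mu>"
  proof (rule caratheodory_empty_continuous)
    show "positive split_algebra ?p" by (simp add: positive_def)
    show "additive split_algebra ?p"
      by (simp add: additive_def upper_variation_Un upper_variation_nonneg)
    fix A :: "nat \<Rightarrow> (('m \<Rightarrow> real) \<times> 'm set) set"
    assume A: "range A \<subseteq> split_algebra" "decseq A" "(\<Inter>n. A n) = {}"
    obtain n where "A n = {}" using split_algebra_decseq_empty[OF A] by blast
    then have "A k = {}" if "n \<le> k" for k using decseqD[OF A(2) that] by blast
    then have "eventually (\<lambda>k. ?p (A k) = 0) sequentially"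
      by (intro eventually_sequentiallyI[of n]) simp
    then show "(\<lambda>k. ?p (A k)) \<longlonglongrightarrow> 0" by (rule tendsto_eventually)
  qed simp
  then obtain \<mu> where \<mu>: "\<And>Y. Y \<in> split_algebra \<Longrightarrow> \<mu> Y = ?p Y"
    and ms: "measure_space split_cube (sigma_sets split_cube split_algebra) \<mu>" by blast
  define N where "N = measure_of split_cube split_algebra \<mu>"
  have sets: "sets N = sigma_sets split_cube split_algebra" and space: "space N = split_cube"
    using space_closed by (simp_all add: N_def)
  have em: "emeasure N Y = \<mu> Y" if "Y \<in> sets N" for Y
    using emeasure_measure_of[OF N_def space_closed] ms that
    by (simp add: sets measure_space_def)
  have meas: "emeasure N Y = ?p Y" if "Y \<in> split_algebra" for Y
    using that by (simp add: em sets \<mu>)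
  have "finite_measure N" by (rule finite_measureI) (simp add: space meas)
  from this space sets show ?thesis
    by (rule that) (simp add: measure_def meas upper_variation_nonneg)
qed

subsection \<open>Cells of the split cube\<close>

text \<open>The preimage of \<open>A\<close> under the projection to the coordinates outside
  \<open>J\<close>, cut down to points that are left limits over \<open>s\<close> in the coordinates
  of \<open>J\<close>. Cells of different \<open>J\<close> may overlap, as \<open>L\<close> can be
  larger than \<open>J\<close>; this matches the expansion over all subsets of
  \<open>L\<close>.\<close>

definition split_cell :: "'m set \<Rightarrow> ('m \<Rightarrow> real) \<Rightarrow> ('m \<Rightarrow> real) set \<Rightarrow> (('m \<Rightarrow> real) \<times> 'm set) set" where
  "split_cell J s A = {(t, L) \<in> split_cube. J \<subseteq> L \<and> (\<forall>j\<in>J. t j = s j) \<and> restrict t (- J) \<in> A}"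

lemma split_cell_UN: "split_cell J s (\<Union>n\<in>I. A n) = (\<Union>n\<in>I. split_cell J s (A n))"
  by (auto simp: split_cell_def)

lemma split_cell_empty: "split_cell J s {} = {}"
  by (auto simp: split_cell_def)

lemma split_cell_disjoint: "A \<inter> B = {} \<Longrightarrow> split_cell J s A \<inter> split_cell J s B = {}"
  by (auto simp: split_cell_def)

lemma split_cell_disjoint':
  assumes "s \<in> J \<rightarrow>\<^sub>E S" "s' \<in> J \<rightarrow>\<^sub>E S" "s \<noteq> s'"
  shows "split_cell J s A \<inter> split_cell J s' A = {}"
proof -
  obtain j where "j \<in> J" "s j \<noteq> s' j" using assms PiE_ext by metis
  then show ?thesis by (auto simp: split_cell_def)
qed

lemma split_set_upper_box_iff:
  fixes t :: "'m::finite \<Rightarrow> real"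
  shows "(t, L) \<in> split_set (upper_box a) \<longleftrightarrow>
    (t, L) \<in> split_cube \<and> (\<forall>i. if i \<in> L then a i < t i else a i \<le> t i)"
proof (cases "(t, L) \<in> split_cube")
  case True
  then show ?thesis by (simp only: split_set_iff eventually_in_upper_box(1)[OF True])
qed (simp add: split_set_iff)

text \<open>The corner 0 in the remaining coordinates imposes nothing, since points of the split
  cube satisfy \<open>0 < t j\<close> for \<open>j \<in> L\<close>.\<close>

lemma split_set_halfspace_iff:
  fixes t :: "'m::finite \<Rightarrow> real"
  assumes "(t, L) \<in> split_cube"
  shows "(t, L) \<in> split_set (upper_box (\<lambda>j. if j = i then c else 0)) \<longleftrightarrow>
    (if i \<in> L then c < t i else c \<le> t i)"
proof -
  have "if j \<in> L then 0 < t j else 0 \<le> t j" for j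
    using assms by (auto simp: split_cube_def unit_cube_iff)
  then show ?thesis using assms by (force simp: split_set_upper_box_iff)
qed

context
  fixes N :: "(('m::finite \<Rightarrow> real) \<times> 'm set) measure"
  assumes space_N: "space N = split_cube"
    and sets_N: "sets N = sigma_sets split_cube split_algebra"
begin

lemma split_set_in_sets: "E \<in> regular_sets \<Longrightarrow> split_set E \<in> sets N"
  by (auto simp: sets_N split_algebra_def)

text \<open>The clopen half-space at \<open>c\<close> contains the point c but not c-. Approaching
  \<open>c\<close> from below by clopen half-spaces gives the half-space with both points over
  \<open>c\<close>.\<close>

lemma split_halfspace_in_sets: "{x \<in> space N. c \<le> fst x i} \<in> sets N"
proof -
  let ?H = "\<lambda>c. split_set (upper_box (\<lambda>j. if j = i then c else 0))"
  have "{x \<in> space N. c \<le> fst x i} = (\<Inter>n. ?H (c - inverse (real (Suc n))))" (is "?l = ?r")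
  proof (intro set_eqI iffI)
    fix x assume "x \<in> ?l"
    then obtain t L where x: "x = (t, L)" "(t, L) \<in> split_cube" "c \<le> t i" by (cases x) (auto simp: space_N)
    have "c - inverse (real (Suc n)) < t i" for n
    proof -
      have "0 < inverse (real (Suc n))" by simp
      with x(3) show ?thesis by linarith
    qed
    then show "x \<in> ?r" using x by (auto simp: split_set_halfspace_iff less_imp_le)
  next
    fix x assume xr: "x \<in> ?r"
    obtain t L where x: "x = (t, L)" by (cases x)
    have tL: "(t, L) \<in> split_cube" using xr split_set_subset x by blast
    have "c - inverse (real (Suc n)) \<le> t i" for n
      using xr split_set_halfspace_iff[OF tL, of i "c - inverse (real (Suc n))"] x
      by (auto simp: less_imp_le split: if_splits)
    moreover have "(\<lambda>n. c - inverse (real (Suc n))) \<longlonglongrightarrow> c"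
      using tendsto_diff[OF tendsto_const LIMSEQ_inverse_real_of_nat] by simp
    ultimately have "c \<le> t i" by (intro LIMSEQ_le_const2) auto
    then show "x \<in> ?l" using x tL by (simp add: space_N)
  qed
  also have "\<dots> \<in> sets N"
    by (intro sets.countable_INT) (auto intro!: split_set_in_sets upper_box_regular)
  finally show ?thesis .
qed

text \<open>The two half-spaces at \<open>c\<close>, with and without c-, differ exactly in the
  points that lie over \<open>c\<close> on the left side.\<close>

lemma split_left_in_sets: "{x \<in> space N. i \<in> snd x \<and> fst x i = c} \<in> sets N"
proof -
  have "{x \<in> space N. i \<in> snd x \<and> fst x i = c} =
      {x \<in> space N. c \<le> fst x i} - split_set (upper_box (\<lambda>j. if j = i then c else 0))"
    by (auto simp: space_N split_set_halfspace_iff split: if_splits)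
  also have "\<dots> \<in> sets N"
    by (intro sets.Diff split_halfspace_in_sets split_set_in_sets upper_box_regular)
  finally show ?thesis .
qed

lemma split_cell_in_sets:
  assumes A: "A \<in> sets (cube_space (- J))"
  shows "split_cell J s A \<in> sets N"
proof -
  have "(\<lambda>x. fst x i) \<in> measurable N (restrict_space borel {0..1})" for i
  proof (rule measurable_restrict_space2)
    show "(\<lambda>x. fst x i) \<in> space N \<rightarrow> {0..1}" by (auto simp: space_N split_cube_def unit_cube_iff)
    show "(\<lambda>x. fst x i) \<in> borel_measurable N"
      unfolding borel_measurable_iff_ge using split_halfspace_in_sets by blast
  qed
  then have "(\<lambda>x. restrict (fst x) (- J)) \<in> measurable N (cube_space (- J))"
    unfolding cube_space_def by (intro measurable_restrict)
  from measurable_sets[OF this A]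
  have "{x \<in> space N. restrict (fst x) (- J) \<in> A} \<in> sets N" by (simp add: vimage_def Int_def conj_commute)
  moreover have "{x \<in> space N. \<forall>j\<in>J. j \<in> snd x \<and> fst x j = s j} \<in> sets N"
    by (intro sets.sets_Collect_finite_All split_left_in_sets) auto
  moreover have "split_cell J s A =
      {x \<in> space N. restrict (fst x) (- J) \<in> A} \<inter> {x \<in> space N. \<forall>j\<in>J. j \<in> snd x \<and> fst x j = s j}"
    by (auto simp: split_cell_def space_N)
  ultimately show ?thesis by (simp only: sets.Int)
qed

end

lemma split_cell_upper_face_iff:
  "(t, L) \<in> split_cell J s (upper_face (- J) a) \<longleftrightarrow>
    (t, L) \<in> split_cube \<and> J \<subseteq> L \<and> (\<forall>j\<in>J. t j = s j) \<and> (\<forall>i\<in>- J. a i \<le> t i)"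
  by (auto simp: split_cell_def upper_face_def space_cube_space split_cube_def unit_cube_iff)

lemma measure_split_set_upper_box:
  fixes N :: "(('m::finite \<Rightarrow> real) \<times> 'm set) measure"
  assumes N: "finite_measure N" and space: "space N = split_cube"
    and sets: "sets N = sigma_sets split_cube split_algebra"
  shows "measure N (split_set (upper_box a)) =
    (\<Sum>J\<in>UNIV. (-1) ^ card J * measure N (split_cell J (restrict a J) (upper_face (- J) a)))"
proof -
  interpret finite_measure N by fact
  let ?C = "\<lambda>J. split_cell J (restrict a J) (upper_face (- J) a)"
  have C: "?C J \<in> sets N" for J by (intro split_cell_in_sets[OF space sets] upper_face_sets)
  have H: "split_set (upper_box a) \<in> sets N" by (intro split_set_in_sets[OF space sets] upper_box_regular)
  have ind: "indicator (split_set (upper_box a)) x = (\<Sum>J\<in>UNIV. (-1) ^ card J * indicator (?C J) x :: real)"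
    if "x \<in> space N" for x
  proof -
    obtain t L where x: "x = (t, L)" by (cases x)
    have tL: "(t, L) \<in> split_cube" using that by (simp add: x space)
    \<comment> \<open>\<open>u\<close> tests the closed condition at \<open>t\<close>;
      \<open>v\<close> corrects it at the left point over \<open>a i\<close>, where
      \<open>t i = a i\<close> is not enough.\<close>
    define u v :: "'m \<Rightarrow> real" where "u i = of_bool (a i \<le> t i)" and "v i = of_bool (i \<in> L \<and> t i = a i)" for i
    have uv: "u i - v i = of_bool (if i \<in> L then a i < t i else a i \<le> t i)" for i
      by (auto simp: u_def v_def)
    have "indicator (split_set (upper_box a)) x = (\<Prod>i\<in>UNIV. u i - v i)"
      using tL by (simp add: uv prod_of_bool x split_set_upper_box_iff indicator_def)
    also have "\<dots> = (\<Sum>J\<in>Pow UNIV. (-1) ^ card J * ((\<Prod>i\<in>J. v i) * (\<Prod>i\<in>UNIV - J. u i)))"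
      by (rule prod_diff_eq_alternating_sum) simp
    also have "\<dots> = (\<Sum>J\<in>UNIV. (-1) ^ card J * indicator (?C J) x)"
    proof (rule sum.cong)
      fix J :: "'m set"
      have "(t, L) \<in> ?C J \<longleftrightarrow> (\<forall>i\<in>J. i \<in> L \<and> t i = a i) \<and> (\<forall>i\<in>UNIV - J. a i \<le> t i)"
        using tL by (auto simp: split_cell_upper_face_iff)
      then show "(-1) ^ card J * ((\<Prod>i\<in>J. v i) * (\<Prod>i\<in>UNIV - J. u i)) = (-1) ^ card J * indicator (?C J) x"
        by (simp add: u_def v_def prod_of_bool x indicator_def)
    qed simp
    finally show ?thesis .
  qed
  have "measure N (split_set (upper_box a)) = (\<integral>x. indicator (split_set (upper_box a)) x \<partial>N)"
    using H sets.sets_into_space[OF H] by (simp add: Int_absorb2 Int_absorb1)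
  also have "\<dots> = (\<integral>x. (\<Sum>J\<in>UNIV. (-1) ^ card J * indicator (?C J) x) \<partial>N)"
    by (intro Bochner_Integration.integral_cong refl ind)
  also have "\<dots> = (\<Sum>J\<in>UNIV. \<integral>x. (-1) ^ card J * indicator (?C J) x \<partial>N)"
    by (rule Bochner_Integration.integral_sum) (simp add: C emeasure_finite less_top[symmetric])
  also have "\<dots> = (\<Sum>J\<in>UNIV. (-1) ^ card J * measure N (?C J))"
    using C sets.sets_into_space[OF C] by (simp add: Int_absorb2 Int_absorb1)
  finally show ?thesis .
qed

subsection \<open>Existence of the representation\<close>

definition functional_charge :: "('m::finite dspace \<Rightarrow>\<^sub>L real) \<Rightarrow> (('m \<Rightarrow> real) \<times> 'm set) set \<Rightarrow> real" where
  "functional_charge \<phi> Y = blinfun_apply \<phi> (dindicator (split_trace Y))"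

lemma abs_blinfun_apply_le:
  fixes \<phi> :: "'m::finite dspace \<Rightarrow>\<^sub>L real"
  assumes "\<And>t. \<bar>dapply f t\<bar> \<le> 1"
  shows "\<bar>blinfun_apply \<phi> f\<bar> \<le> norm \<phi>"
proof -
  have "norm (blinfun_apply \<phi> f) \<le> norm \<phi> * norm f" by (rule norm_blinfun)
  also have "\<dots> \<le> norm \<phi> * 1"
    by (intro mult_left_mono norm_dspace_leI assms) auto
  finally show ?thesis by simp
qed

lemma charge_functional_charge:
  fixes \<phi> :: "'m::finite dspace \<Rightarrow>\<^sub>L real"
  shows "charge split_cube split_algebra (functional_charge \<phi>)"
proof -
  interpret algebra split_cube split_algebra by (rule algebra_split_algebra)
  show ?thesis
  proof
    have "dindicator {} = (0 :: 'm dspace)"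
      by (rule dspace_eqI) (simp add: dapply_dindicator zero_dspace.rep_eq)
    then show "functional_charge \<phi> {} = 0"
      by (simp add: functional_charge_def split_trace_def blinfun.zero_right)
  next
    fix A B :: "(('m \<Rightarrow> real) \<times> 'm set) set" assume AB: "A \<in> split_algebra" "B \<in> split_algebra" "A \<inter> B = {}"
    have tr: "split_trace (A \<union> B) = split_trace A \<union> split_trace B" "split_trace A \<inter> split_trace B = {}"
      using AB(3) by (auto simp: split_trace_def)
    have reg: "split_trace A \<in> regular_sets" "split_trace B \<in> regular_sets"
      using split_algebra_cases AB(1,2) by blast+
    have "dindicator (split_trace (A \<union> B)) = dindicator (split_trace A) + dindicator (split_trace B)"
      using reg tr(2)
      by (intro dspace_eqI)
        (simp add: plus_dspace.rep_eq dapply_dindicator regular_sets_Un tr(1) indicator_add)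
    then show "functional_charge \<phi> (A \<union> B) = functional_charge \<phi> A + functional_charge \<phi> B"
      by (simp add: functional_charge_def blinfun.add_right)
  next
    show "\<exists>c. \<forall>A\<in>split_algebra. \<bar>functional_charge \<phi> A\<bar> \<le> c"
    proof (intro exI ballI)
      fix A :: "(('m \<Rightarrow> real) \<times> 'm set) set" assume "A \<in> split_algebra"
      then have "split_trace A \<in> regular_sets" using split_algebra_cases by blast
      then show "\<bar>functional_charge \<phi> A\<bar> \<le> norm \<phi>"
        unfolding functional_charge_def
        by (intro abs_blinfun_apply_le) (simp add: dapply_dindicator indicator_def)
    qed
  qed
qed

text \<open>The function that is 1 on a regular set and -1 on its complement in the cube has sup
  norm at most 1, so the total variation of the charge is at most the norm of the
  functional.\<close>

lemma functional_charge_sum_le: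
  fixes \<phi> :: "'m::finite dspace \<Rightarrow>\<^sub>L real"
  shows "upper_variation split_algebra (functional_charge \<phi>) split_cube
    + upper_variation split_algebra (\<lambda>Y. - functional_charge \<phi> Y) split_cube \<le> norm \<phi>"
proof -
  interpret charge split_cube split_algebra "functional_charge \<phi>" by (rule charge_functional_charge)
  show ?thesis
  proof (rule upper_variation_sum_le)
    fix B :: "(('m \<Rightarrow> real) \<times> 'm set) set" assume "B \<in> split_algebra"
    then have E: "split_trace B \<in> regular_sets" and B: "B = split_set (split_trace B)"
      using split_algebra_cases by blast+
    have "split_trace (split_cube - B) = unit_cube - split_trace B"
      by (subst B) (simp add: split_set_Compl[OF E, symmetric] split_trace_split_set regular_sets_Compl E)
    then have "functional_charge \<phi> B - functional_charge \<phi> (split_cube - B)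
        = blinfun_apply \<phi> (dindicator (split_trace B) - dindicator (unit_cube - split_trace B))"
      by (simp add: functional_charge_def blinfun.diff_right)
    also have "\<dots> \<le> norm \<phi>"
      by (rule order_trans[OF abs_ge_self abs_blinfun_apply_le])
        (auto simp: minus_dspace.rep_eq dapply_dindicator E regular_sets_Compl indicator_def)
    finally show "functional_charge \<phi> B - functional_charge \<phi> (split_cube - B) \<le> norm \<phi>" .
  qed
qed

lemma (in finite_measure) sum_measure_le:
  assumes "finite I" "A ` I \<subseteq> sets M" "disjoint_family_on A I"
  shows "(\<Sum>i\<in>I. measure M (A i)) \<le> measure M (space M)"
  using finite_measure_finite_Union[OF assms] by (metis bounded_measure)

section \<open>The family of measures cut out by the cells\<close>

locale split_measures =
  fixes N1 N2 :: "(('m::{finite,linorder} \<Rightarrow> real) \<times> 'm set) measure"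
  assumes finite: "finite_measure N1" "finite_measure N2"
    and space: "space N1 = split_cube" "space N2 = split_cube"
    and sets: "sets N1 = sigma_sets split_cube split_algebra" "sets N2 = sigma_sets split_cube split_algebra"
begin

interpretation n1: finite_measure N1 by (rule finite)
interpretation n2: finite_measure N2 by (rule finite)

definition cell_family :: "'m measure_family" where
  "cell_family J s A = (-1) ^ card J * (measure N1 (split_cell J s A) - measure N2 (split_cell J s A))"

lemma cell_in_sets:
  "A \<in> sets (cube_space (- J)) \<Longrightarrow> split_cell J s A \<in> sets N1"
  "A \<in> sets (cube_space (- J)) \<Longrightarrow> split_cell J s A \<in> sets N2"
  by (rule split_cell_in_sets[OF space(1) sets(1)], assumption)
    (rule split_cell_in_sets[OF space(2) sets(2)], assumption)

lemma signed_measure_cell_family: "signed_measure (cube_space (- J)) (cell_family J s)"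
  unfolding cell_family_def
  by (rule signed_measure_diff_measure[OF finite _ cell_in_sets(2) split_cell_empty split_cell_UN split_cell_disjoint])
    (simp add: sets)

text \<open>A positive set function dominating the variation of \<open>cell_family\<close>. The
  locale does not assume \<open>N1\<close> and \<open>N2\<close> mutually singular, so it serves as
  an upper bound.\<close>

definition cell_mass :: "'m set \<Rightarrow> ('m \<Rightarrow> real) \<Rightarrow> ('m \<Rightarrow> real) set \<Rightarrow> real" where
  "cell_mass J s A = measure N1 (split_cell J s A) + measure N2 (split_cell J s A)"

lemma abs_cell_family_le: "\<bar>cell_family J s A\<bar> \<le> cell_mass J s A"
proof -
  have "\<bar>cell_family J s A\<bar> = \<bar>measure N1 (split_cell J s A) - measure N2 (split_cell J s A)\<bar>"
    by (simp add: cell_family_def abs_mult)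
  also have "\<dots> \<le> cell_mass J s A"
    unfolding cell_mass_def
    using measure_nonneg[of N1 "split_cell J s A"] measure_nonneg[of N2 "split_cell J s A"] by linarith
  finally show ?thesis .
qed

lemma total_variation_cell_family:
  "total_variation (cube_space (- J)) (cell_family J s) \<le> ennreal (cell_mass J s (space (cube_space (- J))))"
  unfolding total_variation_def
proof (rule SUP_least, elim CollectE conjE)
  fix P assume P: "finite P" "P \<subseteq> sets (cube_space (- J))" "partition_on (space (cube_space (- J))) P"
  have disj: "disjoint_family_on (split_cell J s) P"
    using P(3) by (auto simp: disjoint_family_on_def partition_on_def disjoint_def intro!: split_cell_disjoint)
  have UN: "(\<Union>A\<in>P. split_cell J s A) = split_cell J s (space (cube_space (- J)))"
    using P(3) split_cell_UN[of J s "\<lambda>A. A" P] by (simp add: partition_on_def)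
  have "(\<Sum>A\<in>P. ennreal \<bar>cell_family J s A\<bar>) \<le> (\<Sum>A\<in>P. ennreal (cell_mass J s A))"
    by (intro sum_mono ennreal_leI abs_cell_family_le)
  also have "\<dots> = ennreal (\<Sum>A\<in>P. cell_mass J s A)"
    by (rule sum_ennreal) (simp add: cell_mass_def)
  also have "(\<Sum>A\<in>P. cell_mass J s A) = cell_mass J s (space (cube_space (- J)))"
    unfolding cell_mass_def sum.distrib UN[symmetric]
    using P disj cell_in_sets
    by (intro arg_cong2[where f = plus] n1.finite_measure_finite_Union[symmetric] n2.finite_measure_finite_Union[symmetric]) auto
  finally show "(\<Sum>A\<in>P. ennreal \<bar>cell_family J s A\<bar>) \<le> ennreal (cell_mass J s (space (cube_space (- J))))" .
qed

text \<open>For fixed \<open>J\<close>, the cells of distinct tuples \<open>s\<close> are disjoint,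
  so their masses add up to at most the total masses of \<open>N1\<close> and \<open>N2\<close>. The
  overlap of cells for different \<open>J\<close> does not enter, because the bound is for each
  \<open>J\<close> separately.\<close>

lemma family_norm_cell_family:
  "family_norm cell_family J \<le> ennreal (measure N1 split_cube + measure N2 split_cube)"
  unfolding family_norm_def
proof (subst nonneg_infsum_complete, simp, rule SUP_least, elim CollectE conjE)
  fix F assume F: "finite F" "F \<subseteq> J \<rightarrow>\<^sub>E {0<..1 :: real}"
  let ?C = "\<lambda>s. split_cell J s (space (cube_space (- J)))"
  have disj: "disjoint_family_on ?C F"
    unfolding disjoint_family_on_def
    by (intro ballI impI split_cell_disjoint'[where S = "{0<..1}"] subsetD[OF F(2)])
  have "(\<Sum>s\<in>F. total_variation (cube_space (- J)) (cell_family J s))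
      \<le> (\<Sum>s\<in>F. ennreal (cell_mass J s (space (cube_space (- J)))))"
    by (intro sum_mono total_variation_cell_family)
  also have "\<dots> = ennreal (\<Sum>s\<in>F. cell_mass J s (space (cube_space (- J))))"
    by (rule sum_ennreal) (simp add: cell_mass_def)
  also have "\<dots> \<le> ennreal (measure N1 split_cube + measure N2 split_cube)"
    unfolding cell_mass_def sum.distrib
    using n1.sum_measure_le[OF F(1) _ disj] n2.sum_measure_le[OF F(1) _ disj]
    by (intro ennreal_leI add_mono) (simp_all add: image_subset_iff cell_in_sets space)
  finally show "(\<Sum>s\<in>F. total_variation (cube_space (- J)) (cell_family J s))
      \<le> ennreal (measure N1 split_cube + measure N2 split_cube)" .
qed

lemma admissible_cell_family: "admissible cell_family"
  unfolding admissible_def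
proof (intro allI conjI ballI)
  show "signed_measure (cube_space (- J)) (cell_family J s)" for J s
    by (rule signed_measure_cell_family)
  show "family_norm cell_family J < \<infinity>" for J
    by (rule le_less_trans[OF family_norm_cell_family]) (simp del: ennreal_plus)
qed

lemma chi_cell_family_upper_box:
  "(\<Sum>J\<in>UNIV. chi_part cell_family J (dindicator (upper_box a))) =
    measure N1 (split_set (upper_box a)) - measure N2 (split_set (upper_box a))"
proof -
  interpret admissible_family cell_family by unfold_locales (rule admissible_cell_family)
  have "chi_part cell_family J (dindicator (upper_box a)) = cell_family J (restrict a J) (upper_face (- J) a)" for J
  proof (cases "\<forall>j\<in>J. 0 < a j \<and> a j \<le> 1")
    case False
    then obtain j where j: "j \<in> J" "\<not> (0 < a j \<and> a j \<le> 1)" by blast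
    \<comment> \<open>The sum defining \<open>chi_part\<close> has no term at this tuple, and the
      cell must be empty to match: \<open>j \<in> L\<close> forces \<open>t j\<close>, which would
      equal \<open>a j\<close>, into (0,1].\<close>
    have "(t, L) \<notin> split_cell J (restrict a J) (upper_face (- J) a)" for t L
    proof
      assume "(t, L) \<in> split_cell J (restrict a J) (upper_face (- J) a)"
      then have "t j = a j" "j \<in> L" "(t, L) \<in> split_cube"
        using j(1) by (auto simp: split_cell_upper_face_iff)
      then show False using j(2) by (auto simp: split_cube_def unit_cube_iff dest!: spec[of _ j])
    qed
    then have "split_cell J (restrict a J) (upper_face (- J) a) = {}" by auto
    then show ?thesis using False by (simp add: chi_part_upper_box cell_family_def)
  qed (simp add: chi_part_upper_box)
  then show ?thesis
    unfolding measure_split_set_upper_box[OF finite(1) space(1) sets(1)]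
      measure_split_set_upper_box[OF finite(2) space(2) sets(2)]
    by (simp add: cell_family_def right_diff_distrib sum_subtractf)
qed

end

lemma exists_representation:
  fixes \<phi> :: "'m::{finite,linorder} dspace \<Rightarrow>\<^sub>L real"
  obtains \<mu> where "represents \<mu> \<phi>" "\<And>J. family_norm \<mu> J \<le> ennreal (norm \<phi>)"
proof -
  interpret charge split_cube split_algebra "functional_charge \<phi>" by (rule charge_functional_charge)
  obtain N1 where N1: "finite_measure N1" "space N1 = split_cube" "sets N1 = sigma_sets split_cube split_algebra"
    "\<And>Y. Y \<in> split_algebra \<Longrightarrow> measure N1 Y = upper_variation split_algebra (functional_charge \<phi>) Y"
    using charge_extension[OF charge_functional_charge] by blast
  obtain N2 where N2: "finite_measure N2" "space N2 = split_cube" "sets N2 = sigma_sets split_cube split_algebra"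
    "\<And>Y. Y \<in> split_algebra \<Longrightarrow> measure N2 Y = upper_variation split_algebra (\<lambda>Y. - functional_charge \<phi> Y) Y"
    using charge_extension[OF charge_uminus] by blast
  interpret split_measures N1 N2 by (intro split_measures.intro N1(1-3) N2(1-3))
  interpret family: admissible_family cell_family by unfold_locales (rule admissible_cell_family)
  have "blinfun_apply \<phi> f = (\<Sum>J\<in>UNIV. chi_part cell_family J f)" for f
  proof (rule bounded_linear_eq_on_upper_boxes[OF blinfun.bounded_linear_right family.chi_bounded_linear])
    fix a :: "'m \<Rightarrow> real"
    have Y: "split_set (upper_box a) \<in> split_algebra"
      using upper_box_regular by (auto simp: split_algebra_def)
    have "blinfun_apply \<phi> (dindicator (upper_box a)) = functional_charge \<phi> (split_set (upper_box a))"
      by (simp add: functional_charge_def split_trace_split_set upper_box_regular)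
    also have "\<dots> = measure N1 (split_set (upper_box a)) - measure N2 (split_set (upper_box a))"
      using upper_variation_jordan[OF Y] by (simp add: N1 N2 Y)
    finally show "blinfun_apply \<phi> (dindicator (upper_box a)) = (\<Sum>J\<in>UNIV. chi_part cell_family J (dindicator (upper_box a)))"
      by (simp add: chi_cell_family_upper_box)
  qed
  then have "represents cell_family \<phi>" by (simp add: represents_def admissible_cell_family)
  moreover have "family_norm cell_family J \<le> ennreal (norm \<phi>)" for J
  proof (rule order_trans[OF family_norm_cell_family], rule ennreal_leI)
    show "measure N1 split_cube + measure N2 split_cube \<le> norm \<phi>"
      using functional_charge_sum_le[of \<phi>] by (simp add: N1(4) N2(4) top)
  qed
  ultimately show ?thesis by (rule that)
qed

subsection \<open>Uniqueness of the representation\<close>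

lemma (in finite_signed_measure) Lim_decseq:
  assumes A: "range A \<subseteq> sets M" "decseq A"
  shows "(\<lambda>n. \<mu> (A n)) \<longlonglongrightarrow> \<mu> (\<Inter>n. A n)"
proof -
  interpret p: finite_measure "positive_part M \<mu>" by (rule finite_positive_part)
  interpret n: finite_measure "negative_part M \<mu>" by (rule finite_negative_part)
  have sets: "A n \<in> sets M" "(\<Inter>n. A n) \<in> sets M" for n using A(1) by auto
  show ?thesis
    unfolding measure_jordan[OF sets(1)] measure_jordan[OF sets(2)]
    using A by (intro tendsto_diff p.finite_Lim_measure_decseq n.finite_Lim_measure_decseq) auto
qed

text \<open>The \<pi>-\<lambda> argument for signed measures. Agreement on the whole space, supplied
  by \<open>space M \<in> G\<close>, is what carries equality over to complements.\<close>

lemma signed_measure_eqI_generator: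
  assumes "finite_signed_measure M \<mu>" "finite_signed_measure M \<nu>"
    and G: "sets M = sigma_sets (space M) G" "Int_stable G" "G \<subseteq> Pow (space M)" "space M \<in> G"
    and eq: "\<And>A. A \<in> G \<Longrightarrow> \<mu> A = \<nu> A" and A: "A \<in> sets M"
  shows "\<mu> A = \<nu> A"
proof -
  interpret \<mu>: finite_signed_measure M \<mu> by fact
  interpret \<nu>: finite_signed_measure M \<nu> by fact
  show ?thesis
    using G(2,3) A[unfolded G(1)]
  proof (induction rule: sigma_sets_induct_disjoint)
    case (compl A)
    then have A: "A \<in> sets M" by (simp add: G(1))
    have "\<mu> (space M - A) = \<mu> (space M) - \<mu> A" "\<nu> (space M - A) = \<nu> (space M) - \<nu> A"
      using sets.sets_into_space[OF A] by (auto intro!: \<mu>.charge_Diff \<nu>.charge_Diff A)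
    then show ?case using compl eq[OF G(4)] by simp
  next
    case (union A)
    then have "range A \<subseteq> sets M" by (simp add: G(1))
    from \<mu>.sums[OF this union(1)] \<nu>.sums[OF this union(1)] show ?case
      by (simp add: union(3) sums_unique2)
  qed (auto simp: eq \<mu>.charge_empty \<nu>.charge_empty)
qed

text \<open>Coordinate half-spaces are upper faces with corner 0 in the other coordinates, so the
  \<sigma>-algebra generated by the upper faces makes all projections measurable and contains the
  product \<sigma>-algebra.\<close>

lemma sets_cube_space_eq_sigma_sets:
  fixes K :: "'m::finite set"
  shows "sets (cube_space K) = sigma_sets (space (cube_space K)) (range (upper_face K))"
proof (rule antisym)
  let ?G = "range (upper_face K)"
  have sub: "?G \<subseteq> Pow (space (cube_space K))" by (auto simp: upper_face_def)
  define N where "N = sigma (space (cube_space K)) ?G"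
  have N: "space N = space (cube_space K)" "sets N = sigma_sets (space (cube_space K)) ?G"
    using sub by (auto simp: N_def)
  have "(\<lambda>x. x i) \<in> measurable N (restrict_space borel {0..1})" if i: "i \<in> K" for i
  proof (rule measurable_restrict_space2)
    show "(\<lambda>x. x i) \<in> space N \<rightarrow> {0..1}" using i by (auto simp: N space_cube_space PiE_iff)
    show "(\<lambda>x. x i) \<in> borel_measurable N"
      unfolding borel_measurable_iff_ge
    proof
      fix c :: real
      have "{x \<in> space N. c \<le> x i} = upper_face K (\<lambda>j. if j = i then c else 0)"
        using i by (auto simp: N upper_face_def space_cube_space PiE_iff)
      then show "{x \<in> space N. c \<le> x i} \<in> sets N" by (auto simp: N)
    qed
  qed
  from measurable_sets[OF this]
  have "{x \<in> space N. x i \<in> A} \<in> sets N" if "i \<in> K" "A \<in> sets (restrict_space borel {0..1})" for i A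
    using that by (simp add: vimage_def Int_def conj_commute)
  then have "sets (PiM K (\<lambda>_. restrict_space borel {0..1})) \<subseteq> sets N"
    by (intro sets_PiM_in_sets) (auto simp: N space_cube_space)
  then show "sets (cube_space K) \<subseteq> sigma_sets (space (cube_space K)) ?G"
    by (simp add: cube_space_def N[unfolded cube_space_def])
  show "sigma_sets (space (cube_space K)) ?G \<subseteq> sets (cube_space K)"
    by (intro sets.sigma_sets_subset) (auto intro: upper_face_sets)
qed

lemma Int_stable_upper_face: "Int_stable (range (upper_face K))"
proof -
  have "upper_face K a \<inter> upper_face K b = upper_face K (\<lambda>i. max (a i) (b i))" for a b
    by (auto simp: upper_face_def)
  then show ?thesis by (auto simp: Int_stable_def)
qed

lemma space_cube_space_upper_face: "space (cube_space K) \<in> range (upper_face K)"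
proof -
  have "space (cube_space K) = upper_face K (\<lambda>_. 0)"
    by (auto simp: upper_face_def space_cube_space dest: PiE_mem)
  then show ?thesis by blast
qed

text \<open>
  Monotonicity of the sequence is ensured by picking its members in disjoint consecutive intervals.
\<close>

lemma upper_face_eq_INT_avoiding:
  fixes b :: "'m::finite \<Rightarrow> real"
  assumes C: "countable C"
  obtains c where "\<And>n i. c n i \<notin> C" "decseq (\<lambda>n. upper_face K (c n))"
    "(\<Inter>n. upper_face K (c n)) = upper_face K b"
proof -
  let ?l = "\<lambda>n i. b i - inverse (real (Suc n))"
  have "\<exists>x. x \<in> {?l n i<..<?l (Suc n) i} \<and> x \<notin> C" for n i
    unfolding Bex_def[symmetric]
    by (rule real_interval_avoid_countable_set[OF _ C]) (simp add: field_simps)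
  then have "\<exists>c. \<forall>n i. c n i \<in> {?l n i<..<?l (Suc n) i} \<and> c n i \<notin> C" by (intro choice allI)
  then obtain c where c: "\<And>n i. ?l n i < c n i" "\<And>n i. c n i < ?l (Suc n) i" "\<And>n i. c n i \<notin> C"
    by auto
  have mono: "c n i \<le> c (Suc n) i" for n i
    using c(2)[of n i] c(1)[of i "Suc n"] by linarith
  have "decseq (\<lambda>n. upper_face K (c n))"
    by (intro decseq_SucI) (auto simp: upper_face_def intro: order_trans[OF mono])
  moreover have "(\<Inter>n. upper_face K (c n)) = upper_face K b"
  proof (intro set_eqI iffI)
    fix x assume x: "x \<in> (\<Inter>n. upper_face K (c n))"
    have "b i \<le> x i" if "i \<in> K" for i
    proof (rule LIMSEQ_le_const2)
      show "(\<lambda>n. ?l n i) \<longlonglongrightarrow> b i"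
        using tendsto_diff[OF tendsto_const LIMSEQ_inverse_real_of_nat] by simp
      have "?l n i \<le> x i" for n
      proof -
        have "c n i \<le> x i" using x that by (auto simp: upper_face_def)
        with c(1)[of i n] show ?thesis by linarith
      qed
      then show "\<exists>N. \<forall>n\<ge>N. ?l n i \<le> x i" by blast
    qed
    then show "x \<in> upper_face K b" using x by (auto simp: upper_face_def)
  next
    fix x assume x: "x \<in> upper_face K b"
    have le: "c n i \<le> b i" for n i
    proof -
      have "0 < inverse (real (Suc (Suc n)))" by simp
      with c(2)[of n i] show ?thesis by linarith
    qed
    then show "x \<in> (\<Inter>n. upper_face K (c n))" using x by (auto simp: upper_face_def intro: order_trans[OF le])
  qed
  ultimately show ?thesis using c(3) that by blast
qed

section \<open>Corners that avoid the atoms of a family\<close>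

context admissible_family
begin

text \<open>Coordinates are collected rather than tuples, so that one \<open>a j\<close> outside
  this set suppresses the contribution of every \<open>J\<close> containing \<open>j\<close>,
  whatever the other coordinates are. The set is countable because a summable family has countable
  support.\<close>

definition atom_coordinates :: "real set" where
  "atom_coordinates = (\<Union>J. \<Union>j\<in>J. (\<lambda>s. s j) ` {s \<in> J \<rightarrow>\<^sub>E {0<..1}. variation J s \<noteq> 0})"

lemma countable_atom_coordinates: "countable atom_coordinates"
proof -
  have "countable {s \<in> J \<rightarrow>\<^sub>E {0<..1}. variation J s \<noteq> 0}" for J
    by (rule summable_countable_real[OF variation_summable])
  then show ?thesis unfolding atom_coordinates_def
    by (intro countable_UN countable_image) (auto intro: countable_finite)
qed

lemma chi_part_upper_box_eq_0:
  assumes j: "j \<in> J" "a j \<notin> atom_coordinates"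
  shows "chi_part \<mu> J (dindicator (upper_box a)) = 0"
proof (cases "\<forall>j\<in>J. 0 < a j \<and> a j \<le> 1")
  case True
  then have s: "restrict a J \<in> J \<rightarrow>\<^sub>E {0<..1}" by auto
  interpret finite_signed_measure "cube_space (- J)" "\<mu> J (restrict a J)"
    by (rule finite_signed_measure[OF s])
  have "variation J (restrict a J) = 0"
  proof (rule ccontr)
    assume "variation J (restrict a J) \<noteq> 0"
    with s have "restrict a J j \<in> atom_coordinates"
      unfolding atom_coordinates_def using j(1) by blast
    then show False using j by simp
  qed
  then have "\<mu> J (restrict a J) (upper_face (- J) a) = 0"
    using abs_le_variation[OF upper_face_sets, of a] by (simp add: variation_def)
  then show ?thesis by (simp add: chi_part_upper_box)
qed (simp only: chi_part_upper_box if_False)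

end

text \<open>
  By induction on \<open>K\<close>, test functions whose coordinates outside \<open>K\<close> avoid the countably many
  atoms isolate the measures with index set \<open>K\<close>.
\<close>

lemma represents_unique:
  fixes \<phi> :: "'m::{finite,linorder} dspace \<Rightarrow>\<^sub>L real"
  assumes "represents \<mu> \<phi>" "represents \<nu> \<phi>"
  shows "same_family \<mu> \<nu>"
proof -
  interpret \<mu>: admissible_family \<mu> using assms by unfold_locales (simp add: represents_def)
  interpret \<nu>: admissible_family \<nu> using assms by unfold_locales (simp add: represents_def)
  define C where "C = \<mu>.atom_coordinates \<union> \<nu>.atom_coordinates"
  have C: "countable C"
    by (simp add: C_def \<mu>.countable_atom_coordinates \<nu>.countable_atom_coordinates)
  have chi_eq: "(\<Sum>J\<in>UNIV. chi_part \<mu> J f) = (\<Sum>J\<in>UNIV. chi_part \<nu> J f)" for f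
    using assms by (metis represents_def)
  have "\<forall>s\<in>K \<rightarrow>\<^sub>E {0<..1}. \<forall>A\<in>sets (cube_space (- K)). \<mu> K s A = \<nu> K s A" for K
  proof (induction K rule: finite_psubset_induct[OF finite])
    case (1 K)
    show ?case
    proof (intro ballI)
      fix s A assume s: "s \<in> K \<rightarrow>\<^sub>E {0<..1::real}" and A: "A \<in> sets (cube_space (- K))"
      interpret m: finite_signed_measure "cube_space (- K)" "\<mu> K s" by (rule \<mu>.finite_signed_measure[OF s])
      interpret n: finite_signed_measure "cube_space (- K)" "\<nu> K s" by (rule \<nu>.finite_signed_measure[OF s])
      have avoid: "\<mu> K s (upper_face (- K) b) = \<nu> K s (upper_face (- K) b)" if b: "\<And>i. b i \<notin> C" for b
      proof -
        \<comment> \<open>On \<open>K\<close> the corner hits the tuple \<open>s\<close> under test,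
          elsewhere it avoids all atoms. Proper subsets of \<open>K\<close> cancel by the induction
          hypothesis, index sets not contained in \<open>K\<close> contribute 0, and the term of
          \<open>K\<close> remains.\<close>
        define a where "a i = (if i \<in> K then s i else b i)" for i
        have cond: "\<forall>j\<in>K. 0 < a j \<and> a j \<le> 1" using s by (auto simp: a_def PiE_iff)
        have restr: "restrict a K = s" using s by (auto simp: a_def fun_eq_iff PiE_iff extensional_def)
        have face: "upper_face (- K) a = upper_face (- K) b" by (auto simp: upper_face_def a_def)
        have other: "chi_part \<mu> J (dindicator (upper_box a)) = chi_part \<nu> J (dindicator (upper_box a))"
          if JK: "J \<noteq> K" for J
        proof (cases "J \<subset> K")
          case True
          have "\<mu> J (restrict a J) (upper_face (- J) a) = \<nu> J (restrict a J) (upper_face (- J) a)"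
            if "\<forall>j\<in>J. 0 < a j \<and> a j \<le> 1"
          proof -
            have "restrict a J \<in> J \<rightarrow>\<^sub>E {0<..1}" using that by (simp only: restrict_PiE_iff greaterThanAtMost_iff)
            then show ?thesis using 1(2)[OF True] upper_face_sets by blast
          qed
          then show ?thesis by (simp add: \<mu>.chi_part_upper_box \<nu>.chi_part_upper_box)
        next
          case False
          then obtain j where "j \<in> J" "j \<notin> K" using JK by blast
          then have "j \<in> J" "a j \<notin> \<mu>.atom_coordinates" "a j \<notin> \<nu>.atom_coordinates"
            using b[of j] by (auto simp: a_def C_def)
          then show ?thesis
            by (simp add: \<mu>.chi_part_upper_box_eq_0 \<nu>.chi_part_upper_box_eq_0)
        qed
        have "(\<Sum>J\<in>UNIV - {K}. chi_part \<mu> J (dindicator (upper_box a))) =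
            (\<Sum>J\<in>UNIV - {K}. chi_part \<nu> J (dindicator (upper_box a)))"
          by (intro sum.cong refl other) simp
        then have "chi_part \<mu> K (dindicator (upper_box a)) = chi_part \<nu> K (dindicator (upper_box a))"
          using chi_eq[of "dindicator (upper_box a)"] by (simp add: sum.remove[of UNIV K])
        then show ?thesis
          using cond by (simp add: \<mu>.chi_part_upper_box \<nu>.chi_part_upper_box restr face)
      qed
      \<comment> \<open>An arbitrary face is a decreasing intersection of faces with avoiding
        corners, along which both signed measures are continuous.\<close>
      have eq: "\<mu> K s (upper_face (- K) b) = \<nu> K s (upper_face (- K) b)" for b
      proof -
        obtain c where c: "\<And>n i. c n i \<notin> C" "decseq (\<lambda>n. upper_face (- K) (c n))"
          "(\<Inter>n. upper_face (- K) (c n)) = upper_face (- K) b"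
          using upper_face_eq_INT_avoiding[OF C] by metis
        have rng: "range (\<lambda>n. upper_face (- K) (c n)) \<subseteq> sets (cube_space (- K))"
          by (intro image_subsetI upper_face_sets)
        have "(\<lambda>n. \<mu> K s (upper_face (- K) (c n))) \<longlonglongrightarrow> \<mu> K s (upper_face (- K) b)"
          using m.Lim_decseq[OF rng c(2)] by (simp only: c(3))
        moreover have "(\<lambda>n. \<nu> K s (upper_face (- K) (c n))) \<longlonglongrightarrow> \<nu> K s (upper_face (- K) b)"
          using n.Lim_decseq[OF rng c(2)] by (simp only: c(3))
        ultimately show ?thesis using avoid[OF c(1)] LIMSEQ_unique by simp
      qed
      have sub: "range (upper_face (- K)) \<subseteq> Pow (space (cube_space (- K)))"
        by (auto simp: upper_face_def)
      show "\<mu> K s A = \<nu> K s A"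
      proof (rule signed_measure_eqI_generator[OF m.finite_signed_measure_axioms n.finite_signed_measure_axioms
            sets_cube_space_eq_sigma_sets Int_stable_upper_face sub space_cube_space_upper_face _ A])
        fix B assume "B \<in> range (upper_face (- K))"
        then obtain b where "B = upper_face (- K) b" by blast
        then show "\<mu> K s B = \<nu> K s B" by (simp only: eq)
      qed
    qed
  qed
  then show ?thesis by (simp add: same_family_def)
qed

theorem theorem4p1:
  shows "(\<forall>\<phi> :: 'm::{finite,linorder} dspace \<Rightarrow>\<^sub>L real.
            \<exists>\<mu>. represents \<mu> \<phi> \<and>
                (\<forall>\<nu>. represents \<nu> \<phi> \<longrightarrow> same_family \<mu> \<nu>) \<and>
                ennreal (norm \<phi> / 2 ^ CARD('m)) \<le> (\<Sum>J\<in>UNIV. family_norm \<mu> J) \<and>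
                (\<Sum>J\<in>UNIV. family_norm \<mu> J) \<le> ennreal (3 ^ CARD('m) * norm \<phi>)) \<and>
         (\<forall>\<mu> :: 'm measure_family. admissible \<mu> \<longrightarrow>
            (\<forall>J f. chi_part_converges \<mu> J f) \<and>
            bounded_linear (\<lambda>f. \<Sum>J\<in>UNIV. chi_part \<mu> J f))"
proof (intro conjI allI impI)
  fix \<phi> :: "'m dspace \<Rightarrow>\<^sub>L real"
  obtain \<mu> where rep: "represents \<mu> \<phi>" and le: "\<And>J. family_norm \<mu> J \<le> ennreal (norm \<phi>)"
    using exists_representation[of \<phi>] by blast
  interpret admissible_family \<mu> using rep by unfold_locales (simp add: represents_def)
  let ?S = "\<Sum>J\<in>UNIV. family_norm \<mu> J"
  have "norm \<phi> \<le> 2 ^ CARD('m) * enn2real ?S"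
    using rep chi_bound by (intro norm_blinfun_bound) (auto simp: represents_def)
  then have "ennreal (norm \<phi> / 2 ^ CARD('m)) \<le> ennreal (enn2real ?S)"
    by (intro ennreal_leI) (simp add: field_simps)
  \<comment> \<open>\<open>enn2real\<close> would send an infinite sum to 0; admissibility excludes
    this.\<close>
  also have "\<dots> = ?S"
    using admissible by (simp add: admissible_def less_top)
  finally have lower: "ennreal (norm \<phi> / 2 ^ CARD('m)) \<le> ?S" .
  \<comment> \<open>One copy of \<open>norm \<phi>\<close> for each of the 2^m index sets, and 2^m
    \<le> 3^m.\<close>
  have "?S \<le> (\<Sum>J\<in>(UNIV :: 'm set set). ennreal (norm \<phi>))" by (intro sum_mono le)
  also have "\<dots> = ennreal (2 ^ CARD('m) * norm \<phi>)"
    by (subst sum_ennreal) (auto simp: card_Pow[of "UNIV :: 'm set", simplified])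
  also have "\<dots> \<le> ennreal (3 ^ CARD('m) * norm \<phi>)"
    by (intro ennreal_leI mult_right_mono power_mono) auto
  finally show "\<exists>\<mu>. represents \<mu> \<phi> \<and> (\<forall>\<nu>. represents \<nu> \<phi> \<longrightarrow> same_family \<mu> \<nu>) \<and>
      ennreal (norm \<phi> / 2 ^ CARD('m)) \<le> (\<Sum>J\<in>UNIV. family_norm \<mu> J) \<and>
      (\<Sum>J\<in>UNIV. family_norm \<mu> J) \<le> ennreal (3 ^ CARD('m) * norm \<phi>)"
    using rep lower represents_unique by blast
next
  fix \<mu> :: "'m measure_family" assume "admissible \<mu>"
  then interpret admissible_family \<mu> by unfold_locales
  show "chi_part_converges \<mu> J f" for J f by (rule chi_part_converges)
  show "bounded_linear (\<lambda>f. \<Sum>J\<in>UNIV. chi_part \<mu> J f)" by (rule chi_bounded_linear)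
qed

end
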